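(* Every triangulation $G$ of the projective plane has a bipartite subgraph $H$ with $|E(H)|\ge \frac{2}{3}|E(G)|-1$.
   Context: A triangulation of a surface is a graph without loops or multiple edges, 2-cell embedded on the surface such that every face is bounded by a closed walk of length 3. *)

theory Defs
  imports Complex_Main
begin

text \<open>A finite simple graph: vertex set V, edges are 2-element subsets of V.\<close>
definition simple_graph :: "'a set \<Rightarrow> 'a set set \<Rightarrow> bool" where
  "simple_graph V E \<longleftrightarrow> finite V \<and> (\<forall>e\<in>E. e \<subseteq> V \<and> card e = 2)"

definition graph_connected :: "'a set \<Rightarrow> 'a set set \<Rightarrow> bool" where
  "graph_connected V E \<longleftrightarrow>
     (\<forall>u\<in>V. \<forall>w\<in>V. (u, w) \<in> {(x, y). {x, y} \<in> E}\<^sup>*)"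

text \<open>Two (labelled) faces are adjacent at vertex v if they share an edge incident with v.\<close>
definition face_adj_at :: "'a \<Rightarrow> 'f set \<Rightarrow> ('f \<Rightarrow> 'a set) \<Rightarrow> ('f \<times> 'f) set" where
  "face_adj_at v F tri = {(f, g). f \<in> F \<and> g \<in> F \<and> f \<noteq> g \<and>
       (\<exists>u. u \<noteq> v \<and> {v, u} \<subseteq> tri f \<and> {v, u} \<subseteq> tri g)}"

text \<open>Combinatorial description of a simple graph 2-cell embedded in a closed surface
  with all faces triangles: F is a finite set of face labels, tri f the vertex set of
  the (triangular) boundary of face f; every edge lies on exactly two faces, and the
  faces around every vertex form a single cyclic rotation (vertex links connected),
  so the glued triangles form a closed surface; the graph is connected.\<close>
definition surface_triangulation ::
  "'a set \<Rightarrow> 'a set set \<Rightarrow> 'f set \<Rightarrow> ('f \<Rightarrow> 'a set) \<Rightarrow> bool" where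
  "surface_triangulation V E F tri \<longleftrightarrow>
     simple_graph V E \<and> graph_connected V E \<and> finite F \<and>
     (\<forall>f\<in>F. tri f \<subseteq> V \<and> card (tri f) = 3 \<and>
        (\<forall>x\<in>tri f. \<forall>y\<in>tri f. x \<noteq> y \<longrightarrow> {x, y} \<in> E)) \<and>
     (\<forall>e\<in>E. card {f\<in>F. e \<subseteq> tri f} = 2) \<and>
     (\<forall>v\<in>V. {f\<in>F. v \<in> tri f} \<noteq> {} \<and>
        (\<forall>f\<in>F. \<forall>g\<in>F. v \<in> tri f \<longrightarrow> v \<in> tri g \<longrightarrow> (f, g) \<in> (face_adj_at v F tri)\<^sup>*))"

text \<open>The surface is connected (graph connected), so by the classification of surfaces
  Euler characteristic 1 means it is the projective plane.\<close>
definition projective_plane_triangulation ::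
  "'a set \<Rightarrow> 'a set set \<Rightarrow> 'f set \<Rightarrow> ('f \<Rightarrow> 'a set) \<Rightarrow> bool" where
  "projective_plane_triangulation V E F tri \<longleftrightarrow>
     surface_triangulation V E F tri \<and>
     int (card V) - int (card E) + int (card F) = 1"

definition bipartite_subgraph :: "'a set set \<Rightarrow> 'a set set \<Rightarrow> bool" where
  "bipartite_subgraph E H \<longleftrightarrow> H \<subseteq> E \<and> (\<exists>A. \<forall>e\<in>H. card (e \<inter> A) = 1)"

end

theory Submission
  imports Defs
begin

text \<open>
  A cut contains zero or two sides of every face, so it suffices to find a cut that contains two sides
  of all faces but at most one. In the dual graph, which is cubic and bridgeless, the edges outside the
  cut then form a near matching: all degrees are 1, up to one exceptional degree 3. Conversely, the
  complement of a near matching is a mod 2 cocycle, and since the Euler characteristic is 1 it is a cut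
  if and only if it meets a fixed noncontractible closed walk \<open>w\<close> evenly.

  Every edge of the dual lies in a perfect matching. If all near matchings met \<open>w\<close> with the same parity,
  then in the dual all cycles that alternate with respect to a fixed perfect matching, except possibly
  at one vertex, would meet \<open>w\<close> evenly. These cycles suffice to build a vertex potential for \<open>w\<close>, so all
  cycles of the dual would meet \<open>w\<close> evenly, contradicting the choice of \<open>w\<close>.
\<close>

section \<open>Alternating paths\<close>

text \<open>Perfect matchings alone would not carry the parity argument: if \<open>w\<close> is 1 on
  every edge, all of them have the same weight, yet every odd cycle has odd weight. Switching a
  perfect matching along an odd cycle that alternates except at one vertex gives that vertex degree
  3 and adds one edge in total; comparing such near matchings controls the odd cycles too. The price
  is the constant in the bound. Counting incidences gives 2|T| \<le> |F| + 2 for the edges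
  \<open>T\<close> outside the cut, and 3|F| = 2|E| turns this into |T| \<le> |E|/3 + 1.

  The other obstacle is that potentials found on two cycles must fit together, although the union of
  the cycles has closed walks that do not alternate. Hence the proof grows sets \<open>A\<close>
  (\<open>linked\<close>) in which every vertex, left along its matching edge, can be joined to
  every matching edge by an alternating path. An excursion out of \<open>A\<close> then always
  closes up inside \<open>A\<close> to a cycle that alternates except possibly at one
  vertex.\<close>

definition degree :: "'a set set \<Rightarrow> 'a \<Rightarrow> nat" where
  "degree E v = card {e \<in> E. v \<in> e}"

definition boundary :: "'a set set \<Rightarrow> 'a set \<Rightarrow> 'a set set" where
  "boundary E X = {e \<in> E. card (e \<inter> X) = 1}"

text \<open>The matching is an involution, so that the partner of a vertex is a term.
  \<open>V\<close> may be a part of a larger graph; matchings of disjoint parts then combine by a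
  case distinction.\<close>

definition perfect_matching :: "'a set \<Rightarrow> 'a set set \<Rightarrow> ('a \<Rightarrow> 'a) \<Rightarrow> bool" where
  "perfect_matching V E m \<longleftrightarrow> (\<forall>v\<in>V. m v \<in> V \<and> m (m v) = v \<and> m v \<noteq> v \<and> {v, m v} \<in> E)"

text \<open>The centre \<open>c\<close> is only a candidate: it may have degree 1 or lie outside
  \<open>V\<close>, so perfect matchings are included.\<close>

definition near_matching :: "'a set \<Rightarrow> 'a set set \<Rightarrow> 'a set set \<Rightarrow> bool" where
  "near_matching V E J \<longleftrightarrow>
     J \<subseteq> E \<and> (\<exists>c. \<forall>v\<in>V. degree J v = 1 \<or> v = c \<and> degree J v = 3)"

text \<open>The list \<open>[z\<^sub>0, z\<^sub>1, \<dots>]\<close> stands for the path \<open>z\<^sub>0, m z\<^sub>0, z\<^sub>1, m z\<^sub>1, \<dots>\<close>, which starts and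
  ends with a matching edge.\<close>
definition alt_path :: "('a \<Rightarrow> 'a) \<Rightarrow> 'a set set \<Rightarrow> 'a list \<Rightarrow> bool" where
  "alt_path m K zs \<longleftrightarrow> zs \<noteq> [] \<and> distinct (zs @ map m zs) \<and>
     (\<forall>z\<in>set zs. {z, m z} \<in> K) \<and> successively (\<lambda>x y. {m x, y} \<in> K) zs"

text \<open>Closure under \<open>m\<close> and the choice \<open>last zs \<in> {y, m y}\<close> make
  this a relation between matching edges: each one, left through either end, leads to each other
  one, in an unspecified direction. A chord can close the path in both cases.\<close>

definition linked :: "('a \<Rightarrow> 'a) \<Rightarrow> 'a set set \<Rightarrow> 'a set \<Rightarrow> bool" where
  "linked m K A \<longleftrightarrow> (\<forall>z\<in>A. m z \<in> A) \<and>
     (\<forall>z\<in>A. \<forall>y\<in>A. \<exists>zs. alt_path m K zs \<and> set zs \<subseteq> A \<and> hd zs = z \<and> last zs \<in> {y, m y})"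

lemma simple_graph_finite_edges: "simple_graph V E \<Longrightarrow> finite E"
  unfolding simple_graph_def by (metis Pow_iff finite_Pow_iff finite_subset subsetI)

lemma degree_insert:
  assumes "finite E" "e \<notin> E"
  shows "degree (insert e E) v = degree E v + of_bool (v \<in> e)"
proof (cases "v \<in> e")
  case True
  then have "{x \<in> insert e E. v \<in> x} = insert e {x \<in> E. v \<in> x}" by auto
  then show ?thesis using True assms by (simp add: degree_def)
next
  case False
  then have "{x \<in> insert e E. v \<in> x} = {x \<in> E. v \<in> x}" by auto
  then show ?thesis using False by (simp add: degree_def)
qed

lemma degree_remove:
  assumes "finite E" "e \<in> E"
  shows "degree (E - {e}) v + of_bool (v \<in> e) = degree E v"
  using degree_insert[of "E - {e}" e v] assms by (simp add: insert_absorb)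

lemma degree_0_notin: "degree E v = 0 \<Longrightarrow> finite E \<Longrightarrow> v \<in> e \<Longrightarrow> e \<notin> E"
  unfolding degree_def by auto

lemma alt_path_singleton: "alt_path m K [z] \<longleftrightarrow> m z \<noteq> z \<and> {z, m z} \<in> K"
  by (auto simp: alt_path_def)

lemma alt_path_appendD1: "alt_path m K (xs @ ys) \<Longrightarrow> xs \<noteq> [] \<Longrightarrow> alt_path m K xs"
  by (auto simp: alt_path_def successively_append_iff)

lemma alt_path_appendD2: "alt_path m K (xs @ ys) \<Longrightarrow> ys \<noteq> [] \<Longrightarrow> alt_path m K ys"
  by (auto simp: alt_path_def successively_append_iff)

lemma alt_path_Cons:
  assumes "ys \<noteq> []"
  shows "alt_path m K (x # ys) \<longleftrightarrow> alt_path m K ys \<and> m x \<noteq> x \<and> x \<notin> set ys \<and> x \<notin> m ` set ys \<and>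
    m x \<notin> set ys \<and> m x \<notin> m ` set ys \<and> {x, m x} \<in> K \<and> {m x, hd ys} \<in> K"
  using assms by (auto simp: alt_path_def successively_Cons)

locale matched_graph =
  fixes V :: "'a set" and E :: "'a set set" and m :: "'a \<Rightarrow> 'a"
  assumes graph: "simple_graph V E" and matching: "perfect_matching V E m"
begin

definition M :: "'a set set" where "M = (\<lambda>v. {v, m v}) ` V"

lemma finV: "finite V" and finE: "finite E"
  using graph simple_graph_finite_edges by (auto simp: simple_graph_def)

lemma m_in: "v \<in> V \<Longrightarrow> m v \<in> V" and m_m: "v \<in> V \<Longrightarrow> m (m v) = v"
  and m_neq: "v \<in> V \<Longrightarrow> m v \<noteq> v" and m_edge: "v \<in> V \<Longrightarrow> {v, m v} \<in> E"
  using matching by (auto simp: perfect_matching_def)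

lemma edgeD: "{a, b} \<in> E \<Longrightarrow> a \<in> V \<and> b \<in> V \<and> a \<noteq> b"
  using graph by (fastforce simp: simple_graph_def)

lemma M_sub: "M \<subseteq> E"
  using m_edge by (auto simp: M_def)

lemma M_edge: "v \<in> V \<Longrightarrow> {v, m v} \<in> M"
  by (auto simp: M_def)

lemma degree_M: "v \<in> V \<Longrightarrow> degree M v = 1"
proof -
  assume v: "v \<in> V"
  have "{e \<in> M. v \<in> e} = {{v, m v}}"
    using v m_m by (auto simp: M_def)
  then show ?thesis by (simp add: degree_def)
qed

lemma alt_path_verts: "alt_path m K zs \<Longrightarrow> K \<subseteq> E \<Longrightarrow> set zs \<subseteq> V"
  using edgeD by (fastforce simp: alt_path_def)

text \<open>As \<open>S\<close> is closed under \<open>m\<close>, the partners of \<open>pre\<close>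
  avoid \<open>S\<close> too. Hence the rest of a path, from its first entry \<open>y\<close> in
  \<open>S\<close> on, can be exchanged for any path inside \<open>S\<close> that starts at
  \<open>y\<close>.\<close>

lemma alt_path_concat:
  assumes "alt_path m K (pre @ [y])" "alt_path m K ys" "hd ys = y" "K \<subseteq> E"
    and "set ys \<subseteq> S" "\<And>z. z \<in> S \<Longrightarrow> m z \<in> S" "set pre \<inter> S = {}"
  shows "alt_path m K (pre @ ys)"
proof -
  obtain zs where ys: "ys = y # zs" using assms(2,3) by (cases ys) (auto simp: alt_path_def)
  have pV: "set pre \<subseteq> V" using alt_path_verts[OF assms(1,4)] by auto
  have mp: "m ` set pre \<inter> S = {}"
  proof -
    have "z \<in> S" if "z \<in> set pre" "m z \<in> S" for z
      using assms(6)[OF that(2)] m_m pV that(1) by auto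
    then show ?thesis using assms(7) by auto
  qed
  have my: "m ` set ys \<subseteq> S" using assms(5,6) by auto
  have "distinct ((pre @ ys) @ map m (pre @ ys))"
  proof -
    have "distinct (pre @ map m pre)" "distinct (ys @ map m ys)"
      using assms(1,2) by (auto simp: alt_path_def)
    moreover have "set pre \<inter> set ys = {}" "set pre \<inter> m ` set ys = {}"
      "m ` set pre \<inter> set ys = {}" "m ` set pre \<inter> m ` set ys = {}"
      using assms(5,7) mp my by blast+
    ultimately show ?thesis by auto
  qed
  then show ?thesis
    using assms(1,2) unfolding ys alt_path_def by (auto simp: successively_append_iff)
qed

lemma linkedD: "linked m K A \<Longrightarrow> z \<in> A \<Longrightarrow> y \<in> A \<Longrightarrow>
    \<exists>zs. alt_path m K zs \<and> set zs \<subseteq> A \<and> hd zs = z \<and> last zs \<in> {y, m y}"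
  and linked_closed: "linked m K A \<Longrightarrow> z \<in> A \<Longrightarrow> m z \<in> A"
  by (auto simp: linked_def)

lemma linked_edge: "linked m K A \<Longrightarrow> z \<in> A \<Longrightarrow> {z, m z} \<in> K"
  using linkedD[of K A z z] by (force simp: alt_path_def)

text \<open>To get from \<open>A\<close> to \<open>B\<close>, follow a path in \<open>A\<close>
  towards a common vertex, stop at its first entry in \<open>B\<close>, and continue inside
  \<open>B\<close>.\<close>

lemma linked_Un:
  assumes A: "linked m K A" and B: "linked m K B" and AB: "A \<inter> B \<noteq> {}" and K: "K \<subseteq> E"
  shows "linked m K (A \<union> B)"
proof -
  have key: "\<exists>zs. alt_path m K zs \<and> set zs \<subseteq> A \<union> B \<and> hd zs = z \<and> last zs \<in> {y, m y}"
    if A: "linked m K A" and B: "linked m K B" and AB: "A \<inter> B \<noteq> {}" and zy: "z \<in> A" "y \<in> B"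
    for A B z y
  proof -
    obtain c where c: "c \<in> A" "c \<in> B" using AB by auto
    obtain zs where zs: "alt_path m K zs" "set zs \<subseteq> A" "hd zs = z" "last zs \<in> {c, m c}"
      using linkedD[OF A zy(1) c(1)] by auto
    have "zs \<noteq> []" using zs by (auto simp: alt_path_def)
    then have "last zs \<in> set zs" by simp
    moreover have "last zs \<in> B" using zs(4) c(2) linked_closed[OF B] by auto
    ultimately have "\<exists>x\<in>set zs. x \<in> B" by auto
    then obtain pre d post where d: "zs = pre @ d # post" "d \<in> B" "\<forall>x\<in>set pre. x \<notin> B"
      using split_list_first_prop[of zs "\<lambda>x. x \<in> B"] by blast
    obtain ys where ys: "alt_path m K ys" "set ys \<subseteq> B" "hd ys = d" "last ys \<in> {y, m y}"
      using linkedD[OF B d(2) zy(2)] by auto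
    have yne: "ys \<noteq> []" using ys by (auto simp: alt_path_def)
    have "alt_path m K (pre @ [d])"
      using zs(1) alt_path_appendD1[of m K "pre @ [d]" post] by (simp add: d)
    then have "alt_path m K (pre @ ys)"
      using alt_path_concat[OF _ ys(1,3) K ys(2)] linked_closed[OF B] d(3) by auto
    moreover have "hd (pre @ ys) = z"
      using zs(3) ys(3) d(1) by (cases pre) auto
    ultimately show ?thesis
      using ys yne zs(2) d(1) by (intro exI[of _ "pre @ ys"]) auto
  qed
  show ?thesis
    unfolding linked_def
  proof (intro conjI ballI)
    show "m z \<in> A \<union> B" if "z \<in> A \<union> B" for z
      using that linked_closed[OF A] linked_closed[OF B] by auto
    fix z y assume "z \<in> A \<union> B" "y \<in> A \<union> B"
    then consider "z \<in> A" "y \<in> A" | "z \<in> A" "y \<in> B" | "z \<in> B" "y \<in> A" | "z \<in> B" "y \<in> B"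
      by auto
    then show "\<exists>zs. alt_path m K zs \<and> set zs \<subseteq> A \<union> B \<and> hd zs = z \<and> last zs \<in> {y, m y}"
    proof cases
      case 1 then show ?thesis using linkedD[OF A] by (meson le_supI1)
    next
      case 2 then show ?thesis using key[OF A B AB] by auto
    next
      case 3 then show ?thesis using key[OF B A] AB by (metis Int_commute Un_commute)
    next
      case 4 then show ?thesis using linkedD[OF B] by (meson le_supI2)
    qed
  qed
qed

text \<open>A single matching edge counts as a cycle \<open>[z]\<close>, closed by the same edge.
  This degenerate case seeds the growth of linked sets and covers a partner shared by two
  matchings.\<close>

definition alt_cycle :: "'a set set \<Rightarrow> 'a list \<Rightarrow> bool" where
  "alt_cycle K zs \<longleftrightarrow> alt_path m K zs \<and> {m (last zs), hd zs} \<in> K"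

lemma alt_cycle_rotate1: 
  assumes "alt_cycle K zs" shows "alt_cycle K (rotate1 zs)"
proof (cases zs)
  case Nil then show ?thesis using assms by (simp add: alt_cycle_def alt_path_def)
next
  case (Cons x xs)
  show ?thesis
  proof (cases "xs = []")
    case True then show ?thesis using assms Cons by simp
  next
    case False
    then show ?thesis using assms Cons
      by (auto simp: alt_cycle_def alt_path_def successively_append_iff successively_Cons)
  qed
qed

lemma alt_cycle_rotate: "alt_cycle K zs \<Longrightarrow> alt_cycle K (rotate n zs)"
  by (induction n) (auto simp: alt_cycle_rotate1)

lemma alt_cycle_rev:
  assumes "alt_cycle K zs" "K \<subseteq> E" shows "alt_cycle K (rev (map m zs))"
proof -
  have zs: "alt_path m K zs" using assms by (auto simp: alt_cycle_def)
  then have ne: "zs \<noteq> []" by (auto simp: alt_path_def)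
  have V: "set zs \<subseteq> V" using alt_path_verts[OF zs assms(2)] .
  have mm: "map m (map m zs) = zs" using V m_m by (auto intro!: map_idI)
  have "distinct (rev (map m zs) @ map m (rev (map m zs)))"
    using zs mm by (auto simp: alt_path_def rev_map[symmetric] simp del: map_map)
  moreover have "\<forall>z\<in>set (rev (map m zs)). {z, m z} \<in> K"
    using zs V m_m by (auto simp: alt_path_def insert_commute)
  moreover have "successively (\<lambda>x y. {m x, y} \<in> K) (rev (map m zs))"
  proof -
    have "successively (\<lambda>x y. {m x, y} \<in> K) zs" using zs by (simp add: alt_path_def)
    then have "successively (\<lambda>x y. {m (m y), m x} \<in> K) zs"
      by (rule successively_mono) (use V m_m in \<open>simp add: insert_commute subset_eq\<close>)
    then show ?thesis by (simp add: successively_map)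
  qed
  moreover have "{m (last (rev (map m zs))), hd (rev (map m zs))} \<in> K"
    using assms(1) ne m_m subsetD[OF V hd_in_set[OF ne]]
    by (auto simp: alt_cycle_def hd_rev last_rev hd_map last_map insert_commute)
  ultimately show ?thesis using ne by (simp add: alt_cycle_def alt_path_def)
qed

text \<open>Rotation makes the cycle start at any entry of the list. Starting at a partner
  \<open>m z\<close> means going round in the other direction, which is the list
  \<open>rev (map m zs)\<close>.\<close>

lemma linked_cycle:
  assumes "alt_cycle K zs" "K \<subseteq> E"
  shows "linked m K (set zs \<union> m ` set zs)"
proof -
  let ?C = "set zs \<union> m ` set zs"
  have V: "set zs \<subseteq> V" using assms alt_path_verts by (auto simp: alt_cycle_def)
  have rot: "\<exists>ys. alt_path m K ys \<and> set ys = set xs \<and> hd ys = z" if xs: "alt_cycle K xs" "z \<in> set xs" for xs z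
  proof -
    obtain i where i: "i < length xs" "z = xs ! i" using xs(2) by (metis in_set_conv_nth)
    have "hd (rotate i xs) = z" using i by (metis hd_rotate_conv_nth list.size(3) mod_less not_less_zero)
    then show ?thesis using alt_cycle_rotate[OF xs(1), of i] by (intro exI[of _ "rotate i xs"]) (auto simp: alt_cycle_def)
  qed
  have start: "\<exists>ys. alt_path m K ys \<and> set ys \<subseteq> ?C \<and> ?C \<subseteq> set ys \<union> m ` set ys \<and> hd ys = z" if "z \<in> ?C" for z
  proof (cases "z \<in> set zs")
    case True
    then show ?thesis using rot[OF assms(1)] by fastforce
  next
    case False
    then have "z \<in> set (rev (map m zs))" using that by auto
    from rot[OF alt_cycle_rev[OF assms] this]
    obtain ys where "alt_path m K ys" "set ys = m ` set zs" "hd ys = z" by auto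
    moreover have "m ` m ` set zs = set zs"
      using V m_m by (simp add: image_image subset_eq)
    ultimately show ?thesis by (intro exI[of _ ys]) simp
  qed
  show ?thesis unfolding linked_def
  proof (intro conjI ballI)
    show "m z \<in> ?C" if "z \<in> ?C" for z using that V m_m by auto
    fix z y assume z: "z \<in> ?C" and y: "y \<in> ?C"
    obtain ys where ys: "alt_path m K ys" "set ys \<subseteq> ?C" "?C \<subseteq> set ys \<union> m ` set ys" "hd ys = z" using start[OF z] by auto
    have "ys \<noteq> []" using ys by (auto simp: alt_path_def)
    have CV: "?C \<subseteq> V" using V m_in by auto
    have "set ys \<subseteq> V" using ys(2) CV by blast
    then have "y \<in> set ys \<or> m y \<in> set ys" using subsetD[OF ys(3) y] m_m by auto
    then obtain t where t: "t \<in> set ys" "t \<in> {y, m y}" by auto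
    then obtain pre post where sp: "ys = pre @ t # post" by (metis split_list)
    have "alt_path m K (pre @ [t])" using ys(1) alt_path_appendD1[of m K "pre @ [t]" post] by (simp add: sp)
    moreover have "hd (pre @ [t]) = z" using ys(4) sp by (cases pre) auto
    ultimately show "\<exists>zs. alt_path m K zs \<and> set zs \<subseteq> ?C \<and> hd zs = z \<and> last zs \<in> {y, m y}"
      using ys(2) sp t by (intro exI[of _ "pre @ [t]"]) auto
  qed
qed

text \<open>The cycle is the component of \<open>v\<close> in the union of the matchings
  \<open>m\<close> and \<open>n\<close>, traversed from \<open>v\<close> along its
  \<open>m\<close>-edge. The last clause records that the remaining edges come from
  \<open>n\<close>; the exchange argument for Tutte's theorem relies on it.\<close>

lemma alternating_cycle_exists:
  assumes n: "perfect_matching V E n" and v: "v \<in> V"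
  shows "\<exists>zs. alt_cycle E zs \<and> hd zs = v \<and> m (last zs) = n v \<and>
     (\<forall>pre x y post. zs = pre @ x # y # post \<longrightarrow> n (m x) = y)"
proof -
  have nV: "n x \<in> V" and nn: "n (n x) = x" and nne: "n x \<noteq> x" and nE: "{x, n x} \<in> E" if "x \<in> V" for x
    using n that by (auto simp: perfect_matching_def)
  \<comment> \<open>A longest path of this kind must close up: its only possible next vertex
    \<open>t\<close> is \<open>v\<close>.\<close>
  define P where "P zs \<longleftrightarrow> alt_path m E zs \<and> hd zs = v \<and> successively (\<lambda>x y. n (m x) = y) zs" for zs
  have P0: "P [v]" using v m_neq m_edge by (auto simp: P_def alt_path_singleton)
  have bound: "length zs \<le> card V" if "P zs" for zs
    using that alt_path_verts[of E zs] distinct_card[of zs] card_mono[OF finV, of "set zs"] by (auto simp: P_def alt_path_def)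
  obtain zs where zs: "P zs" "\<forall>ys. P ys \<longrightarrow> length ys \<le> length zs"
    using ex_has_greatest_nat[of P "[v]" length "Suc (card V)"] P0 bound by (metis less_Suc_eq_le)
  have ap: "alt_path m E zs" and hd: "hd zs = v" using zs by (auto simp: P_def)
  have ne: "zs \<noteq> []" using ap by (auto simp: alt_path_def)
  have V: "set zs \<subseteq> V" using alt_path_verts[OF ap] by simp
  define l where "l = last zs"
  have l: "l \<in> set zs" "l \<in> V" using ne V by (auto simp: l_def)
  define t where "t = n (m l)"
  have tV: "t \<in> V" using nV m_in l by (auto simp: t_def)
  have "n t = m l" using nn m_in l by (auto simp: t_def)
  have dist: "distinct (zs @ map m zs)" using ap by (simp add: alt_path_def)
  have suc: "n (m x) = y" if "zs = pre @ x # y # post" for pre x y post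
    using zs(1) that by (auto simp: P_def successively_append_iff successively_Cons)
  have "t = v"
  proof (rule ccontr)
    assume tv: "t \<noteq> v"
    have t1: "t \<notin> set zs"
    proof
      assume "t \<in> set zs"
      then obtain pre post where sp: "zs = pre @ t # post" by (metis split_list)
      then have "pre \<noteq> []" using hd tv by auto
      then obtain pre' x where "pre = pre' @ [x]" by (metis rev_exhaust)
      then have sp2: "zs = pre' @ x # t # post" using sp by simp
      then have "n (m x) = t" using suc by blast
      moreover have xV: "x \<in> V" using V sp2 by auto
      ultimately have "m x = m l" using \<open>n t = m l\<close> nn[OF m_in[OF xV]] by simp
      then have "x = l" using m_m[OF xV] m_m[OF l(2)] by metis
      moreover have "l \<in> set (t # post)" using sp2 by (simp add: l_def)
      ultimately show False using dist sp2 by auto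
    qed
    \<comment> \<open>If \<open>t = m x\<close>, the entry after \<open>x\<close> would be
      \<open>n (m x) = m l\<close>, which is a partner and not an entry; if \<open>x = l\<close>,
      then \<open>n\<close> would fix \<open>t\<close>.\<close>
    have t2: "t \<notin> m ` set zs"
    proof
      assume "t \<in> m ` set zs"
      then obtain x where x: "x \<in> set zs" "t = m x" by auto
      then have "n (m x) = m l" using \<open>n t = m l\<close> by simp
      show False
      proof (cases "x = l")
        case True then show False using \<open>n t = m l\<close> x nne tV by auto
      next
        case False
        obtain pre post where sp: "zs = pre @ x # post" using x by (metis split_list)
        then have "post \<noteq> []" using False by (auto simp: l_def)
        then obtain y post' where "post = y # post'" by (cases post) auto
        then have "y \<in> set zs" "n (m x) = y" using suc sp by auto
        then show False using dist l \<open>n (m x) = m l\<close> by auto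
      qed
    qed
    have "m t \<notin> set zs" using t2 m_m[OF tV] by (metis imageI)
    moreover have "m t \<notin> m ` set zs" using t1 m_m[OF tV] m_m V by (metis (no_types, lifting) imageE subsetD)
    moreover have "{m l, t} \<in> E" using nE m_in l by (auto simp: t_def)
    ultimately have "P (zs @ [t])"
      using zs(1) ne t1 t2 m_neq[OF tV] m_edge[OF tV]
      by (auto simp: P_def alt_path_def successively_append_iff l_def t_def)
    then show False using zs(2) by fastforce
  qed
  then have "m l = n v" using \<open>n t = m l\<close> by simp
  moreover have "{n v, v} \<in> E" using nE[OF v] by (simp add: insert_commute)
  ultimately show ?thesis using ap hd suc by (intro exI[of _ zs]) (auto simp: alt_cycle_def l_def)
qed

end

section \<open>Potentials\<close>

text \<open>For \<open>e = {a, b}\<close> the sum is \<open>p a + p b\<close>, so these are the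
  edges on which \<open>w\<close> is, mod 2, the coboundary of the potential
  \<open>p\<close>.\<close>

definition balanced :: "('a set \<Rightarrow> int) \<Rightarrow> ('a \<Rightarrow> int) \<Rightarrow> 'a set set \<Rightarrow> 'a set set" where
  "balanced w p E = {e \<in> E. even (w e + sum p e)}"

lemma alt_path_mono:
  assumes "alt_path m K zs"
    and "\<And>e. e \<in> K \<Longrightarrow> e \<subseteq> set zs \<union> m ` set zs \<Longrightarrow> e \<in> K'"
  shows "alt_path m K' zs"
proof -
  have "successively (\<lambda>x y. {m x, y} \<in> K') zs"
    using assms(1) by (auto simp: alt_path_def intro!: assms(2) elim!: successively_mono)
  then show ?thesis
    using assms by (auto simp: alt_path_def)
qed

lemma even_cancel: "even ((a::int) + b + c) \<Longrightarrow> even (a + d + e) \<Longrightarrow> even (b + d + c + e)"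
  by presburger

text \<open>The assumption \<open>near\<close> is the contrary hypothesis of the parity theorem: all
  near matchings have the parity of \<open>M\<close>.\<close>

locale weighted_matched_graph = matched_graph +
  fixes w :: "'a set \<Rightarrow> int"
  assumes near: "near_matching V E J \<Longrightarrow> even (sum w J + sum w M)"
begin

abbreviation bal :: "('a \<Rightarrow> int) \<Rightarrow> 'a set set" where
  "bal p \<equiv> balanced w p E"

lemma bal_sub: "bal p \<subseteq> E"
  by (auto simp: balanced_def)

lemma bal_edge: "{a, b} \<in> bal p \<longleftrightarrow> {a, b} \<in> E \<and> even (w {a, b} + p a + p b)"
  using edgeD by (auto simp: balanced_def add.assoc)

text \<open>The constant \<open>c\<close> enters once at each end of the edge and cancels mod
  2.\<close>

lemma bal_shift:
  assumes "e \<in> bal q" "\<And>v. v \<in> e \<Longrightarrow> even (p v + q v + c)"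
  shows "e \<in> bal p"
proof -
  have e: "e \<in> E" using assms by (auto simp: balanced_def)
  then have "card e = 2" using graph by (auto simp: simple_graph_def)
  then obtain a b where "e = {a, b}" by (auto simp: card_2_iff)
  then show ?thesis
    using assms(1) assms(2)[of a] assms(2)[of b] e by (auto simp: bal_edge)
qed

lemma alt_path_shift:
  assumes "alt_path m (bal q) zs" "\<And>v. v \<in> set zs \<union> m ` set zs \<Longrightarrow> even (p v + q v + c)"
  shows "alt_path m (bal p) zs"
  by (rule alt_path_mono[OF assms(1)]) (use assms(2) in \<open>blast intro: bal_shift\<close>)

lemma linked_shift:
  assumes "linked m (bal q) A" "\<And>v. v \<in> A \<Longrightarrow> even (p v + q v + c)"
  shows "linked m (bal p) A"
  unfolding linked_def
proof (intro conjI ballI)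
  show "m z \<in> A" if "z \<in> A" for z using linked_closed[OF assms(1) that] .
  fix z y assume zy: "z \<in> A" "y \<in> A"
  obtain zs where zs: "alt_path m (bal q) zs" "set zs \<subseteq> A" "hd zs = z" "last zs \<in> {y, m y}"
    using linkedD[OF assms(1) zy] by auto
  have "alt_path m (bal p) zs"
    using zs assms(2) linked_closed[OF assms(1)] by (intro alt_path_shift[OF zs(1)]) blast
  then show "\<exists>zs. alt_path m (bal p) zs \<and> set zs \<subseteq> A \<and> hd zs = z \<and> last zs \<in> {y, m y}"
    using zs by blast
qed

text \<open>\<open>N\<close> is \<open>M\<close> switched along the path, so it exposes just the two
  ends. The potential telescopes along balanced edges, and only its end values remain.\<close>

lemma alt_path_matching:
  assumes "alt_path m (bal p) zs"
  shows "\<exists>N\<subseteq>E. (\<forall>v\<in>V. degree N v = (if v = hd zs \<or> v = m (last zs) then 0 else 1)) \<and>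
    (\<forall>v\<in>V - set zs - m ` set zs. {v, m v} \<in> N) \<and>
    even (sum w N + sum w M + p (hd zs) + p (m (last zs)))"
  using assms
proof (induction zs)
  case Nil
  then show ?case by (simp add: alt_path_def)
next
  case (Cons x ys)
  have xV: "x \<in> V" using alt_path_verts[OF Cons.prems bal_sub] by simp
  have finM: "finite M" using M_sub finE finite_subset by blast
  have xM: "{x, m x} \<in> M" using M_edge xV by blast
  show ?case
  proof (cases "ys = []")
    case True
    have ev: "even (w {x, m x} + p x + p (m x))" 
      using Cons.prems True by (simp add: alt_path_singleton bal_edge)
    have "sum w M = w {x, m x} + sum w (M - {{x, m x}})"
      using sum.remove[OF finM xM] .
    then have 1: "even (sum w (M - {{x, m x}}) + sum w M + p x + p (m x))"
      using ev by (auto simp: algebra_simps)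
    have 2: "degree (M - {{x, m x}}) v = (if v = x \<or> v = m x then 0 else 1)" if "v \<in> V" for v
      using degree_remove[OF finM xM, of v] degree_M[OF that] by (auto split: if_splits)
    have 3: "{v, m v} \<in> M - {{x, m x}}" if "v \<in> V" "v \<noteq> x" "v \<noteq> m x" for v
      using that M_edge by (auto simp: doubleton_eq_iff)
    show ?thesis
      using True 1 2 3 M_sub by (intro exI[of _ "M - {{x, m x}}"]) auto
  next
    case False
    define y where "y = hd ys"
    have ap: "alt_path m (bal p) ys" "m x \<noteq> x" "x \<notin> set ys" "x \<notin> m ` set ys" "m x \<notin> set ys"
      "m x \<notin> m ` set ys" "{x, m x} \<in> bal p" "{m x, y} \<in> bal p"
      using Cons.prems False by (auto simp: alt_path_Cons y_def)
    obtain N where N: "N \<subseteq> E" "\<forall>v\<in>V. degree N v = (if v = y \<or> v = m (last ys) then 0 else 1)"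
      "\<forall>v\<in>V - set ys - m ` set ys. {v, m v} \<in> N" "even (sum w N + sum w M + p y + p (m (last ys)))"
      using Cons.IH[OF ap(1)] unfolding y_def by blast
    have finN: "finite N" using N(1) finE finite_subset by blast
    have yset: "y \<in> set ys" "last ys \<in> set ys" using False by (auto simp: y_def)
    have "set ys \<inter> m ` set ys = {}" using ap(1) by (simp add: alt_path_def)
    then have yneq: "y \<noteq> x" "y \<noteq> m x" "y \<noteq> m (last ys)" "m (last ys) \<noteq> x" "m (last ys) \<noteq> m x"
      using ap yset imageI[OF yset(2), of m] by (metis disjoint_iff)+
    have yV: "y \<in> V" using alt_path_verts[OF ap(1) bal_sub] yset by auto
    have xN: "{x, m x} \<in> N" using N(3) xV ap by auto
    have yN: "{m x, y} \<notin> N" by (rule degree_0_notin[of _ y]) (use bspec[OF N(2) yV] finN in auto)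
    \<comment> \<open>\<open>N\<close> exposes \<open>y\<close>; trading the matching edge at
      \<open>x\<close> for the edge from \<open>m x\<close> to \<open>y\<close> covers
      \<open>y\<close> and exposes \<open>x\<close> instead.\<close>
    let ?N = "insert {m x, y} (N - {{x, m x}})"
    have deg: "degree ?N v + of_bool (v = x \<or> v = m x) = degree N v + of_bool (v = m x \<or> v = y)" for v
      using degree_insert[of "N - {{x, m x}}" "{m x, y}" v] degree_remove[OF finN xN, of v] finN yN by auto
    have 1: "degree ?N v = (if v = x \<or> v = m (last ys) then 0 else 1)" if "v \<in> V" for v
      using deg[of v] bspec[OF N(2) that] ap(2) yneq by (auto split: if_splits)
    have 2: "{v, m v} \<in> ?N" if "v \<in> V - set (x # ys) - m ` set (x # ys)" for v
      using that bspec[OF N(3), of v] by (auto simp: doubleton_eq_iff)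
    have "sum w ?N = w {m x, y} + (sum w N - w {x, m x})"
      using sum.insert[of "N - {{x, m x}}" "{m x, y}" w] finN yN sum.remove[OF finN xN, of w] by auto
    then have 3: "even (sum w ?N + sum w M + p x + p (m (last ys)))"
      using N(4) ap(7,8) by (auto simp: bal_edge)
    have "?N \<subseteq> E" using N(1) ap(8) bal_sub by auto
    then show ?thesis
      using 1 2 3 False by (intro exI[of _ ?N]) (auto simp: y_def)
  qed
qed

text \<open>This is where \<open>near\<close> takes effect. A chord to the far end completes the
  switched matching to a perfect one. A chord to \<open>last zs\<close> closes an odd cycle; with
  the last matching edge put back, \<open>last zs\<close> has degree 3 and all other degrees are
  1.\<close>

lemma alt_path_close:
  assumes zs: "alt_path m (bal p) zs" and y: "y \<in> {last zs, m (last zs)}" and e: "{hd zs, y} \<in> E"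
  shows "{hd zs, y} \<in> bal p"
proof -
  obtain N where N: "N \<subseteq> E" "\<forall>v\<in>V. degree N v = (if v = hd zs \<or> v = m (last zs) then 0 else 1)"
      "even (sum w N + sum w M + p (hd zs) + p (m (last zs)))"
    using alt_path_matching[OF zs] by blast
  have finN: "finite N" using N(1) finE finite_subset by blast
  have ne: "zs \<noteq> []" using zs by (auto simp: alt_path_def)
  have hV: "hd zs \<in> V" and lV: "last zs \<in> V"
    using subsetD[OF alt_path_verts[OF zs bal_sub]] hd_in_set[OF ne] last_in_set[OF ne] by auto
  have mlV: "m (last zs) \<in> V" using m_in[OF lV] .
  have "set zs \<inter> m ` set zs = {}" using zs by (simp add: alt_path_def)
  then have hl: "hd zs \<noteq> m (last zs)"
    using hd_in_set[OF ne] last_in_set[OF ne] by (metis IntI empty_iff imageI)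
  have hN: "{hd zs, y} \<notin> N" by (rule degree_0_notin[of _ "hd zs"]) (use bspec[OF N(2) hV] finN in auto)
  show ?thesis
  proof (cases "y = m (last zs)")
    case True
    let ?J = "insert {hd zs, y} N"
    have "near_matching V E ?J"
      unfolding near_matching_def
      using N e degree_insert[OF finN hN] True by auto
    from near[OF this] show ?thesis
      using N(3) hN finN e True by (auto simp: bal_edge)
  next
    case False
    then have yl: "y = last zs" using y by auto
    have yh: "y \<noteq> hd zs" using e edgeD by blast
    let ?e = "{y, m y}"
    have eE: "?e \<in> bal p" "?e \<in> E" using zs ne yl m_edge lV by (auto simp: alt_path_def)
    have eN: "?e \<notin> N" by (rule degree_0_notin[of _ "m (last zs)"]) (use bspec[OF N(2) mlV] finN yl in auto)
    let ?N = "insert ?e N"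
    have hN': "{hd zs, y} \<notin> ?N" using hN hl yl yh by (auto simp: doubleton_eq_iff)
    let ?J = "insert {hd zs, y} ?N"
    have "degree ?J v = degree N v + of_bool (v = y \<or> v = m y) + of_bool (v = hd zs \<or> v = y)" for v
      using degree_insert[OF finN eN, of v] degree_insert[OF _ hN', of v] finN by auto
    then have "near_matching V E ?J"
      unfolding near_matching_def
      using N(1,2) e eE(2) yl yh hl m_neq[OF lV] by auto
    from near[OF this] show ?thesis
      using N(3) hN' eN finN e eE(1) yl by (auto simp: bal_edge)
  qed
qed

text \<open>A path has no cycle, so values propagate from its end to its head, each new vertex
  balancing the edge that reaches it.\<close>

lemma alt_path_potential:
  assumes "alt_path m E zs" shows "\<exists>p. alt_path m (bal p) zs"
  using assms
proof (induction zs)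
  case Nil
  then show ?case by (simp add: alt_path_def)
next
  case (Cons x ys)
  show ?case
  proof (cases "ys = []")
    case True
    then have "alt_path m (bal (\<lambda>v. if v = x then w {x, m x} else 0)) [x]"
      using Cons.prems by (auto simp: alt_path_singleton bal_edge)
    then show ?thesis using True by blast
  next
    case False
    have ap: "alt_path m E ys" "m x \<noteq> x" "x \<notin> set ys" "x \<notin> m ` set ys" "m x \<notin> set ys"
      "m x \<notin> m ` set ys" "{x, m x} \<in> E" "{m x, hd ys} \<in> E"
      using Cons.prems False by (auto simp: alt_path_Cons)
    obtain p where p: "alt_path m (bal p) ys" using Cons.IH ap by auto
    define a where "a = p (hd ys) + w {m x, hd ys}"
    define q where "q = p(m x := a, x := a + w {x, m x})"
    have "\<forall>z\<in>set ys. m z \<noteq> m x \<and> m z \<noteq> x" using ap(4,6) image_eqI by metis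
    then have "alt_path m (bal q) ys"
      by (intro alt_path_shift[OF p, where c = 0]) (use ap in \<open>auto simp: q_def\<close>)
    moreover have "hd ys \<noteq> x" "hd ys \<noteq> m x" using hd_in_set[OF False] ap(3,5) by metis+
    ultimately have "alt_path m (bal q) (x # ys)"
      using ap False by (auto simp: alt_path_Cons bal_edge q_def a_def)
    then show ?thesis by blast
  qed
qed

lemma alt_cycle_potential:
  assumes "alt_cycle E zs" shows "\<exists>p. alt_cycle (bal p) zs"
proof -
  obtain p where p: "alt_path m (bal p) zs" using assms alt_path_potential by (auto simp: alt_cycle_def)
  have "{hd zs, m (last zs)} \<in> bal p"
    using alt_path_close[OF p, of "m (last zs)"] assms by (simp add: alt_cycle_def insert_commute[of "m (last zs)"])
  then show ?thesis using p by (auto simp: alt_cycle_def insert_commute)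
qed

text \<open>A first return to \<open>A\<close> closes up through \<open>A\<close>, so the two potentials differ by the
  same amount at both ends of the excursion.\<close>
lemma potentials_differ_const:
  assumes A: "linked m (bal p) A"
  shows "alt_path m (bal q) zs \<Longrightarrow> hd zs \<in> A \<Longrightarrow> t \<in> set zs \<inter> A \<Longrightarrow>
    even (p t + q t + p (hd zs) + q (hd zs))"
proof (induction zs rule: length_induct)
  case (1 zs)
  have zs: "alt_path m (bal q) zs" by fact
  obtain x rest where zsx: "zs = x # rest" using zs by (cases zs) (auto simp: alt_path_def)
  have xA: "x \<in> A" using 1 zsx by simp
  show ?case
  proof (cases "set rest \<inter> A = {}")
    case True
    then show ?thesis using 1 zsx by auto
  next
    case False
    then have "\<exists>y\<in>set rest. y \<in> A" by auto
    then obtain pre y post where r: "rest = pre @ y # post" "y \<in> A" "\<forall>z\<in>set pre. z \<notin> A"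
      using split_list_first_prop[of rest "\<lambda>x. x \<in> A"] by blast
    have V: "set zs \<subseteq> V" using alt_path_verts[OF zs bal_sub] .
    have Am: "m z \<in> A" if "z \<in> A" for z using linked_closed[OF A that] .
    have dm: "even (p z + q z + p (m z) + q (m z))" if "z \<in> set zs" "z \<in> A" for z
    proof -
      have "{z, m z} \<in> bal q" using zs that by (auto simp: alt_path_def)
      moreover have "{z, m z} \<in> bal p" using linked_edge[OF A that(2)] .
      ultimately show ?thesis unfolding bal_edge by (blast intro: even_cancel)
    qed
    define c where "c = p y + q y"
    \<comment> \<open>\<open>p'\<close> follows \<open>p\<close> inside \<open>A\<close> and
      \<open>q\<close> outside, shifted by \<open>c\<close> so that the excursion \<open>pre\<close>
      fits \<open>p\<close> at the vertex \<open>y\<close> of its return.\<close>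
    define p' where "p' v = (if v \<in> A then p v else q v + c)" for v
    have zs': "zs = (x # pre @ [y]) @ post" by (simp add: zsx r)
    have ap1: "alt_path m (bal q) (x # pre @ [y])" using zs alt_path_appendD1 unfolding zs' by blast
    then have ap2: "alt_path m (bal q) (pre @ [y])" by (simp add: alt_path_Cons)
    have mpre: "m z \<notin> A" if "z \<in> set pre" for z
      using that r(3) Am[of "m z"] m_m V zs' by auto
    have ap3: "alt_path m (bal p') (pre @ [y])"
    proof (rule alt_path_shift[OF ap2, where c = c])
      fix v assume "v \<in> set (pre @ [y]) \<union> m ` set (pre @ [y])"
      then consider "v \<in> set pre \<union> m ` set pre" | "v = y" | "v = m y" by auto
      then show "even (p' v + q v + c)"
        using mpre r(2,3) Am[OF r(2)] dm[of y] zs' by cases (auto simp: p'_def c_def)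
    qed
    obtain ys where ys: "alt_path m (bal p) ys" "set ys \<subseteq> A" "hd ys = y" "last ys \<in> {x, m x}"
      using linkedD[OF A r(2) xA] by auto
    have yne: "ys \<noteq> []" using ys by (auto simp: alt_path_def)
    have ap4: "alt_path m (bal p') ys"
      by (rule alt_path_shift[OF ys(1), where c = 0]) (use ys(2) Am in \<open>auto simp: p'_def\<close>)
    have ap5: "alt_path m (bal p') (pre @ ys)"
      using alt_path_concat[OF ap3 ap4 ys(3) bal_sub ys(2)] Am r(3) by auto
    define h where "h = hd (pre @ ys)"
    have h: "h = hd (pre @ [y])" using ys(3) by (cases pre) (auto simp: h_def)
    have edge: "{m x, h} \<in> bal q" using ap1 by (simp add: alt_path_Cons h)
    \<comment> \<open>The edge from \<open>m x\<close> to the next entry is now a chord between the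
      head of \<open>pre @ ys\<close> and its last matching edge, hence balanced for
      \<open>p'\<close>. Comparison with \<open>q\<close> shows that \<open>p + q\<close> is
      \<open>c\<close> at \<open>m x\<close> too.\<close>
    have "m x \<in> {last (pre @ ys), m (last (pre @ ys))}"
      using ys(4) yne m_m V zsx by auto
    then have "{h, m x} \<in> bal p'"
      using alt_path_close[OF ap5, of "m x"] edge bal_sub by (auto simp: h_def insert_commute)
    then have "even (w {m x, h} + p' h + p (m x))"
      using Am[OF xA] by (simp add: bal_edge insert_commute p'_def)
    moreover have "even (w {m x, h} + q h + q (m x))" using edge by (auto simp: bal_edge)
    moreover have "even (p' h + q h + c)"
      using r by (cases pre) (auto simp: p'_def c_def h)
    ultimately have "even (p (m x) + q (m x) + c)" by presburger
    then have xy: "even (p x + q x + p y + q y)" using dm[of x] xA zsx by (auto simp: c_def)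
    have ap6: "alt_path m (bal q) (y # post)"
      using zs alt_path_appendD2[of m "bal q" "x # pre" "y # post"] by (simp add: zsx r)
    show ?thesis
    proof (cases "t \<in> set (y # post)")
      case True
      then have "even (p t + q t + p y + q y)"
        using 1 ap6 r(2) zsx r(1) by (auto dest!: spec[of _ "y # post"])
      then show ?thesis using xy zsx by auto
    next
      case False
      then have "t = x" using 1 r zsx by auto
      then show ?thesis using zsx by simp
    qed
  qed
qed

text \<open>On \<open>A \<inter> B\<close> the sum \<open>p + q\<close> is constant mod 2: a path in
  \<open>B\<close> from \<open>x\<close> reaches every such vertex or its partner, and all its
  entries in \<open>A\<close> give the same value. One shift of \<open>q\<close> then makes the
  potentials agree.\<close>

lemma linked_glue:
  assumes A: "linked m (bal p) A" and B: "linked m (bal q) B" and x: "x \<in> A" "x \<in> B"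
  shows "\<exists>r. linked m (bal r) (A \<union> B)"
proof -
  define c where "c = p x + q x"
  define r where "r v = (if v \<in> A then p v else q v + c)" for v
  have d: "even (p v + q v + c)" if v: "v \<in> A" "v \<in> B" for v
  proof -
    obtain zs where zs: "alt_path m (bal q) zs" "set zs \<subseteq> B" "hd zs = x" "last zs \<in> {v, m v}"
      using linkedD[OF B x(2) v(2)] by auto
    have "zs \<noteq> []" using zs by (auto simp: alt_path_def)
    then have "last zs \<in> set zs" by simp
    moreover have "last zs \<in> A" using zs(4) v(1) linked_closed[OF A] by auto
    ultimately have "even (p (last zs) + q (last zs) + c)"
      using potentials_differ_const[OF A zs(1), of "last zs"] zs(3) x(1) by (auto simp: c_def add.assoc)
    moreover have "even (p v + q v + p (m v) + q (m v))"
      using linked_edge[OF A v(1)] linked_edge[OF B v(2)] unfolding bal_edge by (blast intro: even_cancel)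
    ultimately show ?thesis using zs(4) by (elim insertE emptyE) (simp_all, presburger?)
  qed
  have "linked m (bal r) A"
    by (rule linked_shift[OF A, where c = 0]) (auto simp: r_def)
  moreover have "linked m (bal r) B"
    by (rule linked_shift[OF B, where c = c]) (use d in \<open>auto simp: r_def\<close>)
  ultimately show ?thesis using linked_Un bal_sub x by blast
qed

text \<open>A largest linked set with a potential is everything: an edge leaving it lies in a
  perfect matching \<open>n\<close>, and the cycle through it that alternates between
  \<open>m\<close> and \<open>n\<close> could be glued on. Every edge is then a chord of an
  alternating path, hence balanced.\<close>

lemma ex_potential:
  assumes "graph_connected V E"
    and "\<And>u v. {u, v} \<in> E \<Longrightarrow> \<exists>n. perfect_matching V E n \<and> n u = v"
  shows "\<exists>p. balanced w p E = E"
proof (cases "V = {}")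
  case True
  then have "E = {}" using graph by (fastforce simp: simple_graph_def)
  then show ?thesis by (simp add: balanced_def)
next
  case False
  then obtain r where r: "r \<in> V" by auto
  define Q where "Q A \<longleftrightarrow> A \<subseteq> V \<and> A \<noteq> {} \<and> (\<exists>p. linked m (bal p) A)" for A
  have cyc: "\<exists>p. linked m (bal p) (set zs \<union> m ` set zs)" if "alt_cycle E zs" for zs
    using alt_cycle_potential[OF that] linked_cycle bal_sub by blast
  have "alt_cycle E [r]"
    using r m_neq m_edge by (simp add: alt_cycle_def alt_path_singleton insert_commute)
  from cyc[OF this] have "\<exists>p. linked m (bal p) {r, m r}" by (simp add: insert_commute)
  then have Q0: "Q {r, m r}" using r m_in by (auto simp: Q_def)
  have "card A \<le> card V" if "Q A" for A using that card_mono[OF finV] by (auto simp: Q_def)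
  then obtain A where A: "Q A" "\<forall>B. Q B \<longrightarrow> card B \<le> card A"
    using ex_has_greatest_nat[of Q "{r, m r}" card "Suc (card V)"] Q0 by (metis less_Suc_eq_le)
  obtain p where p: "linked m (bal p) A" using A(1) by (auto simp: Q_def)
  have AV: "A \<subseteq> V" "A \<noteq> {}" using A(1) by (auto simp: Q_def)
  have cl: "v \<in> A" if uA: "u \<in> A" and uvE: "{u, v} \<in> E" for u v
  proof (rule ccontr)
    assume v: "v \<notin> A"
    have uv: "u \<in> V" "v \<in> V" using edgeD that by auto
    obtain n where n: "perfect_matching V E n" "n v = u"
      using assms(2)[of v u] uvE by (auto simp: insert_commute)
    obtain zs where zs: "alt_cycle E zs" "hd zs = v" "m (last zs) = u"
      using alternating_cycle_exists[OF n(1) uv(2)] n(2) by auto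
    have ne: "zs \<noteq> []" using zs by (auto simp: alt_cycle_def alt_path_def)
    define C where "C = set zs \<union> m ` set zs"
    have C: "v \<in> C" "u \<in> C" using zs ne by (auto simp: C_def)
    have CV: "C \<subseteq> V" using alt_path_verts[of E zs] zs(1) m_in by (auto simp: C_def alt_cycle_def)
    obtain q where "linked m (bal q) C" using cyc[OF zs(1)] by (auto simp: C_def)
    from linked_glue[OF p this that(1) C(2)] have "Q (A \<union> C)" using AV CV by (auto simp: Q_def)
    then have "card (A \<union> C) \<le> card A" using A(2) by blast
    moreover have "card A < card (A \<union> C)"
      using finV AV CV C v by (intro psubset_card_mono) (auto intro: finite_subset)
    ultimately show False by simp
  qed
  have "V \<subseteq> A"
  proof
    fix v assume "v \<in> V"
    obtain a where a: "a \<in> A" using AV by auto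
    then have "(a, v) \<in> {(x, y). {x, y} \<in> E}\<^sup>*" using assms(1) AV \<open>v \<in> V\<close> by (auto simp: graph_connected_def)
    then show "v \<in> A" by induction (use a cl in auto)
  qed
  have "e \<in> bal p" if "e \<in> E" for e
  proof -
    have "card e = 2" using graph that by (auto simp: simple_graph_def)
    then obtain a b where e: "e = {a, b}" by (auto simp: card_2_iff)
    then have ab: "a \<in> A" "b \<in> A" using edgeD that \<open>V \<subseteq> A\<close> by auto
    obtain zs where zs: "alt_path m (bal p) zs" "hd zs = a" "last zs \<in> {b, m b}"
      using linkedD[OF p ab] by auto
    have "b \<in> {last zs, m (last zs)}" using zs(3) m_m ab AV by auto
    from alt_path_close[OF zs(1) this] show ?thesis using zs(2) that e by auto
  qed
  then show ?thesis using bal_sub by blast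
qed

end

section \<open>Perfect matchings of cubic graphs\<close>

lemma sum_degree:
  assumes "finite E" "finite X" "\<And>e. e \<in> E \<Longrightarrow> card e = 2"
  shows "(\<Sum>v\<in>X. degree E v) = card (boundary E X) + 2 * card {e \<in> E. e \<subseteq> X}"
proof -
  have eq: "card (e \<inter> X) = of_bool (card (e \<inter> X) = 1) + 2 * of_bool (e \<subseteq> X)" if "e \<in> E" for e
  proof -
    have fe: "finite e" "card e = 2" using assms(3)[OF that] by (auto intro: card_ge_0_finite)
    have "card (e \<inter> X) \<le> 2" using fe card_mono[of e "e \<inter> X"] by auto
    moreover have "card (e \<inter> X) = 2 \<longleftrightarrow> e \<subseteq> X"
      using fe card_subset_eq[of e "e \<inter> X"] by (auto simp: Int_absorb2)
    ultimately show ?thesis by (cases "e \<subseteq> X") auto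
  qed
  have "(\<Sum>v\<in>X. degree E v) = (\<Sum>v\<in>X. \<Sum>e\<in>E. of_bool (v \<in> e))"
    using assms(1) by (simp add: degree_def Collect_conj_eq Int_commute)
  also have "\<dots> = (\<Sum>e\<in>E. \<Sum>v\<in>X. of_bool (v \<in> e))" by (rule sum.swap)
  also have "\<dots> = (\<Sum>e\<in>E. card (e \<inter> X))"
    using assms(2) by (intro sum.cong) (auto simp: Int_commute)
  also have "\<dots> = (\<Sum>e\<in>E. of_bool (card (e \<inter> X) = 1) + 2 * of_bool (e \<subseteq> X))"
    using eq by (rule sum.cong[OF refl])
  also have "\<dots> = card (boundary E X) + 2 * card {e \<in> E. e \<subseteq> X}"
    using assms(1) by (simp add: sum.distrib sum_distrib_left[symmetric] boundary_def Collect_conj_eq Int_commute)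
  finally show ?thesis .
qed

section \<open>Assembling perfect matchings, and Tutte's theorem\<close>

lemma perfect_matching_mono: "perfect_matching A E m \<Longrightarrow> E \<subseteq> E' \<Longrightarrow> perfect_matching A E' m"
  by (auto simp: perfect_matching_def)

lemma perfect_matching_Un:
  assumes "perfect_matching A E m" "perfect_matching B E n" "A \<inter> B = {}"
  shows "perfect_matching (A \<union> B) E (\<lambda>v. if v \<in> A then m v else n v)"
  using assms by (auto simp: perfect_matching_def)

lemma perfect_matching_UN:
  assumes "finite I" "\<And>i. i \<in> I \<Longrightarrow> \<exists>m. perfect_matching (A i) E m"
    and "\<And>i j. i \<in> I \<Longrightarrow> j \<in> I \<Longrightarrow> i \<noteq> j \<Longrightarrow> A i \<inter> A j = {}"
  shows "\<exists>m. perfect_matching (\<Union>i\<in>I. A i) E m"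
  using assms
proof (induction I)
  case empty
  then show ?case by (simp add: perfect_matching_def)
next
  case (insert i I)
  obtain m n where "perfect_matching (A i) E m" "perfect_matching (\<Union>i\<in>I. A i) E n"
    using insert by (metis insert_iff)
  moreover have "A i \<inter> A j = {}" if "j \<in> I" for j
    using insert.prems(2)[of i j] insert.hyps that by auto
  then have "A i \<inter> (\<Union>i\<in>I. A i) = {}" by auto
  ultimately have "\<exists>k. perfect_matching (A i \<union> (\<Union>i\<in>I. A i)) E k"
    using perfect_matching_Un by blast
  then show ?case by simp
qed

lemma perfect_matching_clique:
  assumes "finite A" "even (card A)" "\<And>x y. x \<in> A \<Longrightarrow> y \<in> A \<Longrightarrow> x \<noteq> y \<Longrightarrow> {x, y} \<in> E"
  shows "\<exists>m. perfect_matching A E m"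
  using assms
proof (induction "card A" arbitrary: A rule: less_induct)
  case less
  show ?case
  proof (cases "A = {}")
    case True
    then have "perfect_matching A E id" by (simp add: perfect_matching_def)
    then show ?thesis by blast
  next
    case False
    then obtain x where x: "x \<in> A" by auto
    then have "card (A - {x}) \<noteq> 0" using less.prems(2) card_Suc_Diff1[OF less.prems(1) x] by auto
    then have "A - {x} \<noteq> {}" by (metis card.empty)
    then obtain y where y: "y \<in> A" "y \<noteq> x" by auto
    have cA: "card (A - {x, y}) = card A - 2" "card A \<ge> 2"
      using x y less.prems(1) card_mono[of A "{x, y}"] by (auto simp: card_Diff_subset)
    obtain m where m: "perfect_matching (A - {x, y}) E m"
      using less.hyps[of "A - {x, y}"] less.prems cA by auto
    have "perfect_matching {x, y} E (\<lambda>v. if v = x then y else x)"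
      using x y less.prems(3)[of x y] by (auto simp: perfect_matching_def insert_commute)
    from perfect_matching_Un[OF m this] have "\<exists>m. perfect_matching ((A - {x, y}) \<union> {x, y}) E m" by auto
    moreover have "(A - {x, y}) \<union> {x, y} = A" using x y by auto
    ultimately show ?thesis by simp
  qed
qed

text \<open>In the union of \<open>m1\<close> and \<open>m2\<close>, take the cycle through the
  added edge \<open>{y, t}\<close>. If it misses \<open>{x, z}\<close>, switching along it avoids
  both added edges. Otherwise it meets \<open>{x, z}\<close> on the way from \<open>t\<close> to
  \<open>y\<close>, and an edge from \<open>y\<close> to \<open>x\<close> or \<open>z\<close> is a
  shortcut that avoids both.\<close>

lemma perfect_matching_exchange:
  assumes G: "simple_graph U E"
    and m1: "perfect_matching U (insert {x, z} E) m1" and m2: "perfect_matching U (insert {y, t} E) m2"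
    and m12: "m1 x = z" "m2 y = t" and E: "{x, y} \<in> E" "{z, y} \<in> E"
    and U: "x \<in> U" "y \<in> U" "z \<in> U" "t \<in> U" and neq: "x \<noteq> z" "y \<noteq> t" "x \<noteq> t" "z \<noteq> t"
  shows "\<exists>m. perfect_matching U E m"
proof -
  let ?E = "insert {x, z} (insert {y, t} E)"
  have G': "simple_graph U ?E" using G U neq by (auto simp: simple_graph_def)
  interpret matched_graph U ?E m1
    by (rule matched_graph.intro[OF G' perfect_matching_mono[OF m1]]) auto
  have m1U: "m1 v \<in> U" and m1m1: "m1 (m1 v) = v" and m1n: "m1 v \<noteq> v" and m1E: "{v, m1 v} \<in> insert {x, z} E"
    if "v \<in> U" for v using m1 that by (auto simp: perfect_matching_def)
  have m2U: "m2 v \<in> U" and m2m2: "m2 (m2 v) = v" and m2n: "m2 v \<noteq> v" and m2E: "{v, m2 v} \<in> insert {y, t} E"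
    if "v \<in> U" for v using m2 that by (auto simp: perfect_matching_def)
  have "m2 t = y" using m12 m2m2 U by auto
  have m2': "perfect_matching U ?E m2" by (rule perfect_matching_mono[OF m2]) auto
  obtain zs where cyc: "alt_cycle ?E zs" and zs': "hd zs = t" "m1 (last zs) = m2 t"
    and steps: "\<forall>pre a b post. zs = pre @ a # b # post \<longrightarrow> m2 (m1 a) = b"
    using alternating_cycle_exists[OF m2' \<open>t \<in> U\<close>] by (elim exE conjE)
  have zs: "alt_path m1 ?E zs" "hd zs = t" "m1 (last zs) = y"
    using cyc zs' \<open>m2 t = y\<close> by (simp_all add: alt_cycle_def)
  have step: "m2 (m1 a) = b" if "zs = pre @ a # b # post" for pre a b post
    using steps that by blast
  have ne: "zs \<noteq> []" using zs by (auto simp: alt_path_def)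
  have zU: "set zs \<subseteq> U" using alt_path_verts[OF zs(1)] by simp
  have dist: "distinct (zs @ map m1 zs)" using zs(1) by (simp add: alt_path_def)
  \<comment> \<open>A prefix of the cycle is closed under \<open>m2\<close> except at its two ends:
    the first vertex \<open>t\<close> is matched to \<open>y\<close>, the last one to the next
    entry.\<close>
  have closed: "m2 v \<in> set pre \<union> m1 ` set pre \<union> (if rest = [] then {} else {hd rest, y})"
    if sp: "zs = pre @ rest" and v: "v \<in> set pre \<union> m1 ` set pre" for pre rest v
  proof (cases "v \<in> set pre")
    case True
    then obtain p1 p2 where p: "pre = p1 @ v # p2" by (metis split_list)
    show ?thesis
    proof (cases p1 rule: rev_cases)
      case Nil
      then have "m2 v = y" using p sp zs(2) \<open>m2 t = y\<close> by auto
      moreover have "y \<in> m1 ` set pre" if "rest = []" using that sp zs(3) ne by (metis append_Nil2 imageI last_in_set)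
      ultimately show ?thesis by auto
    next
      case (snoc p u)
      then have "m2 (m1 u) = v" using step[of p u v "p2 @ rest"] p sp by simp
      then have "m2 v = m1 u" using m2m2[OF m1U] snoc p sp zU by auto
      then show ?thesis using snoc p by auto
    qed
  next
    case False
    then obtain u where u: "u \<in> set pre" "v = m1 u" using v by auto
    then obtain p1 p2 where p: "pre = p1 @ u # p2" by (metis split_list)
    show ?thesis
    proof (cases "p2 @ rest")
      case Nil
      then have "last zs = u" using p sp by simp
      then have "m2 v = t" using u zs(3) m12 by simp
      moreover have "t \<in> set pre" using zs(2) sp p by (cases p1) auto
      ultimately show ?thesis by simp
    next
      case (Cons b q)
      then have "m2 v = b" using step[of p1 u b q] p sp u by simp
      then show ?thesis using Cons p by (cases p2) auto
    qed
  qed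
  show ?thesis
  proof (cases "x \<in> set zs \<union> m1 ` set zs")
    case False
    define C where "C = set zs \<union> m1 ` set zs"
    have CU: "C \<subseteq> U" using zU m1U by (auto simp: C_def)
    have C1: "m1 v \<in> C" if "v \<in> C" for v using that m1m1 zU by (auto simp: C_def)
    have C2: "m2 v \<in> C" if "v \<in> C" for v using closed[of zs "[]" v] that by (simp add: C_def)
    have C3: "m2 v \<notin> C" if "v \<in> U" "v \<notin> C" for v using C2[of "m2 v"] m2m2 that by auto
    have "t \<in> C" "y \<in> C" using zs(2,3) ne by (auto simp: C_def)
    moreover have "x \<notin> C" using False by (simp add: C_def)
    moreover have "z \<notin> C" using C1[of z] m1m1[of x] m12(1) U(1) \<open>x \<notin> C\<close> by auto
    ultimately have "{v, m1 v} \<in> E" if "v \<in> C" for v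
      using m1E[of v] that CU C1[OF that] by (auto simp: doubleton_eq_iff)
    moreover have "{v, m2 v} \<in> E" if "v \<in> U" "v \<notin> C" for v
      using m2E[of v] that C3[OF that] \<open>t \<in> C\<close> \<open>y \<in> C\<close> by (auto simp: doubleton_eq_iff)
    ultimately have "perfect_matching U E (\<lambda>v. if v \<in> C then m1 v else m2 v)"
      using C1 C3 m1U m1m1 m1n m2U m2m2 m2n CU by (auto simp: perfect_matching_def)
    then show ?thesis by blast
  next
    case True
    then have "x \<in> set zs \<or> z \<in> set zs" using m12(1) m1m1 zU by auto
    \<comment> \<open>\<open>a\<close> is the end of \<open>{x, z}\<close> reached first from
      \<open>t\<close>. Both ends are adjacent to \<open>y\<close>, so it does not matter which one
      it is.\<close>
    then have "\<exists>a b. a \<in> set zs \<and> b = m1 a \<and> {a, b} = {x, z}"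
      using m12(1) m1m1[OF U(1)] by (metis insert_commute)
    then obtain a b where a: "a \<in> set zs" "b = m1 a" "{a, b} = {x, z}" by blast
    then have aU: "a \<in> U" "a \<noteq> t" "{a, y} \<in> E" using zU neq E by (auto simp: doubleton_eq_iff)
    obtain pre post where sp: "zs = pre @ a # post" using a(1) by (metis split_list)
    have pne: "pre \<noteq> []" using sp zs(2) aU by auto
    define P where "P = set pre \<union> m1 ` set pre"
    have PU: "P \<subseteq> U" using zU m1U sp by (auto simp: P_def)
    have P1: "m1 v \<in> P" if "v \<in> P" for v using that m1m1 zU sp by (auto simp: P_def)
    have aP: "a \<notin> P" "b \<notin> P"
    proof -
      show "a \<notin> P" using dist sp by (auto simp: P_def)
      then show "b \<notin> P" using P1[of b] a m1m1 zU by auto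
    qed
    have l: "last zs \<in> set (a # post)" by (simp add: sp)
    have yP: "y \<notin> P"
    proof
      assume "y \<in> P"
      then have "m1 (m1 (last zs)) \<in> P" using P1 zs(3) by simp
      then have "last zs \<in> P" using m1m1 subsetD[OF zU last_in_set[OF ne]] by simp
      moreover have "last zs \<notin> set pre" using l dist sp by auto
      moreover have "last zs \<notin> m1 ` set pre" using l dist sp by auto
      ultimately show False by (auto simp: P_def)
    qed
    have ya: "y \<noteq> a" using aU G by (fastforce simp: simple_graph_def)
    have tP: "t \<in> P" using zs(2) sp pne by (auto simp: P_def)
    define D where "D = P \<union> {a, y}"
    have D2: "m2 v \<in> D" if vD: "v \<in> D" for v
    proof -
      consider "v \<in> P" | "v = a" | "v = y" using vD by (auto simp: D_def)
      then show ?thesis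
      proof cases
        case 1
        then show ?thesis using closed[of pre "a # post" v] sp by (auto simp: P_def D_def)
      next
        case 2
        obtain p u where p: "pre = p @ [u]" using pne by (metis rev_exhaust)
        then have "m2 (m1 u) = a" using step[of p u a post] sp by simp
        then have "m2 a = m1 u" using m2m2[OF m1U] p sp zU by auto
        then show ?thesis using p 2 by (auto simp: D_def P_def)
      next
        case 3
        then show ?thesis using m12 tP by (auto simp: D_def)
      qed
    qed
    have D3: "m2 v \<notin> D" if "v \<in> U" "v \<notin> D" for v using D2[of "m2 v"] m2m2 that by auto
    have e1: "{v, m1 v} \<in> E" if "v \<in> P" for v
    proof -
      have "{v, m1 v} \<noteq> {x, z}" using that aP a(3) by (auto simp: doubleton_eq_iff)
      then show ?thesis using m1E[of v] that PU by auto
    qed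
    have e2: "{v, m2 v} \<in> E" if "v \<in> U" "v \<notin> D" for v
      using m2E[of v] that D3[OF that] by (auto simp: doubleton_eq_iff D_def)
    \<comment> \<open>Before \<open>a\<close> the matching is \<open>m1\<close>, then comes the
      shortcut \<open>{a, y}\<close>, and elsewhere it is \<open>m2\<close>. This is consistent
      because \<open>P\<close> is closed under \<open>m1\<close> and \<open>D\<close> under
      \<open>m2\<close>.\<close>
    define m where "m v = (if v \<in> P then m1 v else if v = a then y else if v = y then a else m2 v)" for v
    have "perfect_matching U E m"
      unfolding perfect_matching_def
    proof
      fix v assume v: "v \<in> U"
      consider "v \<in> P" | "v = a" | "v = y" | "v \<notin> D" by (auto simp: D_def)
      then show "m v \<in> U \<and> m (m v) = v \<and> m v \<noteq> v \<and> {v, m v} \<in> E"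
      proof cases
        case 1
        then show ?thesis using P1 e1 m1U m1m1 m1n v by (auto simp: m_def)
      next
        case 2
        then show ?thesis using aP yP ya aU U by (auto simp: m_def)
      next
        case 3
        then show ?thesis using aP yP ya aU U by (auto simp: m_def insert_commute)
      next
        case 4
        then show ?thesis using D3[OF v 4] e2[OF v 4] m2U m2m2 m2n v by (auto simp: m_def D_def)
      qed
    qed
    then show ?thesis by blast
  qed
qed

text \<open>Tutte's theorem, by Lovasz's argument: in an edge-maximal graph without a perfect matching,
  adjacency is transitive outside the set of universal vertices.\<close>
lemma tutte_barrier:
  assumes G: "simple_graph U E" and even: "even (card U)" and none: "\<nexists>m. perfect_matching U E m"
  shows "\<exists>S \<K>. S \<subseteq> U \<and> finite \<K> \<and> pairwise disjnt \<K> \<and> card S + 2 \<le> card \<K> \<and>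
    (\<forall>K\<in>\<K>. K \<subseteq> U - S \<and> odd (card K) \<and> (\<forall>x\<in>K. \<forall>y\<in>U - S - K. {x, y} \<notin> E))"
proof -
  have finU: "finite U" using G by (simp add: simple_graph_def)
  define All where "All = {e. e \<subseteq> U \<and> card e = 2}"
  have finAll: "finite All" using finU by (auto simp: All_def intro: finite_subset[of _ "Pow U"])
  have EAll: "E \<subseteq> All" using G by (auto simp: All_def simple_graph_def)
  define Q where "Q = {E'. E \<subseteq> E' \<and> E' \<subseteq> All \<and> (\<nexists>m. perfect_matching U E' m)}"
  have "finite Q" using finAll by (auto simp: Q_def intro: finite_subset[of _ "Pow All"])
  moreover have "E \<in> Q" using EAll none by (auto simp: Q_def)
  ultimately obtain H where HQ: "H \<in> Q" and Hmax: "\<And>E'. E' \<in> Q \<Longrightarrow> H \<subseteq> E' \<Longrightarrow> E' = H"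
    using finite_has_maximal2[of Q E] by metis
  have H: "E \<subseteq> H" "H \<subseteq> All" "\<nexists>m. perfect_matching U H m" using HQ by (auto simp: Q_def)
  have GH: "simple_graph U H" using H finU by (auto simp: simple_graph_def All_def)
  have add: "\<exists>m. perfect_matching U (insert {x, y} H) m \<and> m x = y"
    if xy: "x \<in> U" "y \<in> U" "x \<noteq> y" "{x, y} \<notin> H" for x y
  proof -
    have "insert {x, y} H \<notin> Q" using Hmax[of "insert {x, y} H"] xy by auto
    then obtain m where m: "perfect_matching U (insert {x, y} H) m"
      using xy H by (auto simp: Q_def All_def)
    have "\<exists>v\<in>U. {v, m v} \<notin> H"
      using m H(3) unfolding perfect_matching_def by metis
    then obtain v where "v \<in> U" "{v, m v} \<notin> H" by blast
    then have "{v, m v} = {x, y}" using m by (auto simp: perfect_matching_def)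
    then have "m x = y" using m \<open>v \<in> U\<close> by (auto simp: perfect_matching_def doubleton_eq_iff)
    then show ?thesis using m by blast
  qed
  define S where "S = {s \<in> U. \<forall>t\<in>U - {s}. {s, t} \<in> H}"
  define W where "W = U - S"
  define r where "r = {(x, y). x \<in> W \<and> y \<in> W \<and> (x = y \<or> {x, y} \<in> H)}"
  have tr: "x = z \<or> {x, z} \<in> H" if xyz: "x \<in> W" "y \<in> W" "z \<in> W" "{x, y} \<in> H" "{y, z} \<in> H" for x y z
  proof (rule ccontr)
    assume n: "\<not> (x = z \<or> {x, z} \<in> H)"
    obtain t where t: "t \<in> U" "t \<noteq> y" "{y, t} \<notin> H" using xyz(2) by (auto simp: W_def S_def)
    have tn: "t \<noteq> x" "t \<noteq> z" using t xyz by (auto simp: insert_commute)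
    obtain m1 where m1: "perfect_matching U (insert {x, z} H) m1" "m1 x = z"
      using add[of x z] n xyz by (auto simp: W_def)
    obtain m2 where m2: "perfect_matching U (insert {y, t} H) m2" "m2 y = t"
      using add[of y t] t xyz by (auto simp: W_def)
    have "\<exists>m. perfect_matching U H m"
      using n t tn xyz
      by (intro perfect_matching_exchange[OF GH m1(1) m2(1) m1(2) m2(2)]) (auto simp: W_def insert_commute)
    then show False using H(3) by blast
  qed
  have eqv: "equiv W r"
    using tr by (auto simp: equiv_def refl_on_def sym_def trans_def r_def insert_commute)
  define C where "C = W // r"
  have finW: "finite W" using finU by (simp add: W_def)
  have finC: "finite C" using finW by (auto simp: C_def r_def intro!: finite_quotient)
  have UC: "\<Union>C = W" using Union_quotient[OF eqv] by (simp add: C_def)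
  have disjC: "K \<inter> L = {}" if "K \<in> C" "L \<in> C" "K \<noteq> L" for K L
    using quotient_disj[OF eqv] that by (auto simp: C_def)
  have KW: "K \<subseteq> W" if "K \<in> C" for K using UC that by auto
  have clique: "{x, y} \<in> H" if "K \<in> C" "x \<in> K" "y \<in> K" "x \<noteq> y" for K x y
    using quotient_eq_iff[OF eqv, of K K x y] that by (auto simp: C_def r_def)
  have sep: "{x, y} \<notin> H" if "K \<in> C" "x \<in> K" "y \<in> W - K" for K x y
    using that in_quotient_imp_closed[OF eqv, of K x y] KW by (auto simp: C_def r_def)
  define \<K> where "\<K> = {K \<in> C. odd (card K)}"
  have fink: "finite \<K>" using finC by (simp add: \<K>_def)
  have SU: "S \<subseteq> U" "finite S" using finU by (auto simp: S_def)
  have "card W = (\<Sum>K\<in>C. card K)"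
    using card_Union_disjoint[of C] disjC KW finW UC
    by (metis (no_types, lifting) disjnt_def finite_subset pairwise_def)
  moreover have "even ((\<Sum>K\<in>C. card K) + card \<K>)"
    using finC by (simp add: even_sum_iff \<K>_def)
  moreover have "card U = card W + card S" using SU finU by (simp add: W_def card_Diff_subset card_mono)
  \<comment> \<open>Parity improves the strict inequality between \<open>card S\<close> and
    \<open>card \<K>\<close> to a gap of two, which later pays for two deleted vertices.\<close>
  ultimately have par: "even (card \<K> + card S)" using even by presburger
  have "card S < card \<K>"
  proof (rule ccontr)
    assume "\<not> card S < card \<K>"
    then obtain f where f: "f ` \<K> \<subseteq> S" "inj_on f \<K>"
      using card_le_inj[OF fink SU(2)] by auto
    \<comment> \<open>If \<open>S\<close> is large enough, each odd class takes its own universal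
      vertex and becomes an even clique. The vertices of \<open>S\<close> left over are even in
      number and pairwise adjacent.\<close>
    define B where "B K = (if K \<in> \<K> then insert (f K) K else K)" for K
    have kS: "K \<inter> S = {}" if "K \<in> C" for K using KW[OF that] by (auto simp: W_def)
    have finB: "finite (B K)" if "K \<in> C" for K using KW[OF that] finW finite_subset by (auto simp: B_def)
    have uni: "{s, t} \<in> H" "{t, s} \<in> H" if "s \<in> S" "t \<in> U" "t \<noteq> s" for s t using that by (auto simp: S_def insert_commute)
    have Bpm: "\<exists>m. perfect_matching (B K) H m" if K: "K \<in> C" for K
    proof (rule perfect_matching_clique)
      show "finite (B K)" using finB K .
      have "f K \<notin> K" if "K \<in> \<K>" using f(1) kS[OF K] that by auto
      then show "even (card (B K))"
        using K finite_subset[OF KW[OF K] finW] by (auto simp: B_def \<K>_def)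
      fix x y assume "x \<in> B K" "y \<in> B K" "x \<noteq> y"
      then show "{x, y} \<in> H"
        using clique[OF K] uni[of "f K"] image_subset_iff[THEN iffD1, OF f(1)] KW[OF K]
        unfolding W_def B_def by (auto split: if_splits)
    qed
    have Bdisj: "B K \<inter> B L = {}" if "K \<in> C" "L \<in> C" "K \<noteq> L" for K L
      using disjC[OF that] kS[OF that(1)] kS[OF that(2)] f that(3) by (auto simp: B_def dest: inj_onD)
    obtain m where m: "perfect_matching (\<Union>K\<in>C. B K) H m"
      using perfect_matching_UN[of C B H] finC Bpm Bdisj by blast
    let ?R = "S - f ` \<K>"
    have "card ?R = card S - card \<K>" "card \<K> \<le> card S"
      using f fink SU card_image[OF f(2)] card_mono[OF SU(2) f(1)] by (auto simp: card_Diff_subset)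
    then have "even (card ?R)" using par by simp
    then obtain n where n: "perfect_matching ?R H n"
      using perfect_matching_clique[of ?R H] SU uni(1) by (metis Diff_iff finite_Diff subsetD)
    have "?R \<inter> (\<Union>K\<in>C. B K) = {}" using kS by (auto simp: B_def split: if_splits)
    from perfect_matching_Un[OF n m this] obtain k where k: "perfect_matching (?R \<union> (\<Union>K\<in>C. B K)) H k" by blast
    have "?R \<union> (\<Union>K\<in>C. B K) = U"
    proof
      have "B K \<subseteq> U" if "K \<in> C" for K
        using SU f(1) KW[OF that] by (auto simp: B_def W_def)
      then show "?R \<union> (\<Union>K\<in>C. B K) \<subseteq> U" using SU by blast
      have "f ` \<K> \<subseteq> (\<Union>K\<in>C. B K)" by (auto simp: B_def \<K>_def)
      moreover have "W \<subseteq> (\<Union>K\<in>C. B K)" using UC by (auto simp: B_def)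
      ultimately show "U \<subseteq> ?R \<union> (\<Union>K\<in>C. B K)" by (auto simp: W_def)
    qed
    then show False using k H(3) by auto
  qed
  then have "card S + 2 \<le> card \<K>" using par by presburger
  moreover have "pairwise disjnt \<K>" using disjC by (auto simp: pairwise_def disjnt_def \<K>_def)
  moreover have "\<forall>K\<in>\<K>. K \<subseteq> U - S \<and> odd (card K) \<and> (\<forall>x\<in>K. \<forall>y\<in>U - S - K. {x, y} \<notin> E)"
    using KW sep H(1) by (auto simp: \<K>_def W_def)
  ultimately show ?thesis using SU fink by blast
qed

text \<open>Delete \<open>u\<close> and \<open>v\<close>. A barrier \<open>S\<close> of the rest
  gives \<open>T = S \<union> {u, v}\<close> and at least \<open>card T\<close> odd pieces, each
  sending at least 3 edges to \<open>T\<close> by parity and bridgelessness. These use up all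
  degrees in \<open>T\<close>, which leaves no room for the edge \<open>{u, v}\<close>.\<close>

lemma cubic_edge_in_perfect_matching:
  assumes G: "simple_graph V E" and cubic: "\<And>v. v \<in> V \<Longrightarrow> degree E v = 3"
    and bridgeless: "\<And>X. X \<subseteq> V \<Longrightarrow> card (boundary E X) \<noteq> 1"
    and uv: "{u, v} \<in> E"
  shows "\<exists>n. perfect_matching V E n \<and> n u = v"
proof -
  have finV: "finite V" and finE: "finite E" and card2: "\<And>e. e \<in> E \<Longrightarrow> card e = 2"
    using G simple_graph_finite_edges by (auto simp: simple_graph_def)
  have uvV: "u \<in> V" "v \<in> V" "u \<noteq> v" using G uv card2[OF uv] by (auto simp: simple_graph_def)
  have sd: "3 * card X = card (boundary E X) + 2 * card {e \<in> E. e \<subseteq> X}" if "X \<subseteq> V" for X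
    using sum_degree[OF finE finite_subset[OF that finV] card2] cubic that by (simp add: subset_eq)
  have noncut: "boundary E V = {}"
    using G by (auto simp: boundary_def simple_graph_def Int_absorb2)
  have evV: "even (card V)"
    using sd[of V] unfolding noncut by simp presburger
  define U where "U = V - {u, v}"
  define EU where "EU = {e \<in> E. e \<subseteq> U}"
  have GU: "simple_graph U EU" using G by (auto simp: simple_graph_def U_def EU_def)
  have cU: "card V = card U + 2"
    using uvV finV card_mono[of V "{u, v}"] by (simp add: U_def card_Diff_subset)
  then have evU: "even (card U)" using evV by simp
  show ?thesis
  proof (cases "\<exists>m. perfect_matching U EU m")
    case True
    then obtain m where m: "perfect_matching U E m" using perfect_matching_mono[of U EU _ E] by (auto simp: EU_def)
    have "perfect_matching {u, v} E (\<lambda>x. if x = u then v else u)"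
      using uvV uv by (auto simp: perfect_matching_def insert_commute)
    from perfect_matching_Un[OF this m] have "perfect_matching ({u, v} \<union> U) E (\<lambda>x. if x \<in> {u, v} then if x = u then v else u else m x)"
      by (auto simp: U_def)
    moreover have "{u, v} \<union> U = V" using uvV by (auto simp: U_def)
    ultimately show ?thesis by fastforce
  next
    case False
    then obtain S \<K> where SK: "S \<subseteq> U" "finite \<K>" "pairwise disjnt \<K>" "card S + 2 \<le> card \<K>"
      "\<forall>K\<in>\<K>. K \<subseteq> U - S \<and> odd (card K) \<and> (\<forall>x\<in>K. \<forall>y\<in>U - S - K. {x, y} \<notin> EU)"
      using tutte_barrier[OF GU evU False] by (elim exE conjE)
    define T where "T = S \<union> {u, v}"
    have fincut: "finite (boundary E X)" for X using finE by (simp add: boundary_def)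
    have TV: "T \<subseteq> V" "card T = card S + 2"
      using SK(1) uvV finite_subset[OF SK(1)] finV by (auto simp: T_def U_def card_insert_if)
    have cut3: "3 \<le> card (boundary E K)" if K: "K \<in> \<K>" for K
    proof -
      have "K \<subseteq> V" "odd (card K)" using bspec[OF SK(5) K] by (auto simp: U_def)
      then have "odd (card (boundary E K))" using sd[of K] unfolding boundary_def by presburger
      moreover have "card (boundary E K) \<noteq> 1" using bridgeless \<open>K \<subseteq> V\<close> by (simp add: boundary_def)
      ultimately show ?thesis by presburger
    qed
    have shape: "\<exists>a b. e = {a, b} \<and> a \<in> K \<and> b \<in> T" if K: "K \<in> \<K>" and e: "e \<in> boundary E K" for K e
    proof -
      have "card (e \<inter> K) = 1" "e \<in> E" using e by (auto simp: boundary_def)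
      then obtain a where a: "e \<inter> K = {a}" by (auto simp: card_1_singleton_iff)
      obtain c d where cd: "e = {c, d}" "c \<noteq> d" using card2[OF \<open>e \<in> E\<close>] by (auto simp: card_2_iff)
      define b where "b = (if a = c then d else c)"
      have b: "e = {a, b}" "a \<noteq> b" using cd a by (auto simp: b_def)
      then have bK: "b \<notin> K" using a by auto
      have bV: "b \<in> V" using G \<open>e \<in> E\<close> b by (auto simp: simple_graph_def)
      have aU: "a \<in> U - S" "a \<in> K" using a bspec[OF SK(5) K] by auto
      have "b \<in> T"
      proof (rule ccontr)
        assume "b \<notin> T"
        then have "b \<in> U - S - K" using bV bK by (auto simp: T_def U_def)
        then have "{a, b} \<notin> EU" using bspec[OF SK(5) K] aU by blast
        then show False using b \<open>e \<in> E\<close> aU \<open>b \<in> U - S - K\<close> by (auto simp: EU_def)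
      qed
      then show ?thesis using b aU by blast
    qed
    have KT: "K \<inter> T = {}" if "K \<in> \<K>" for K using bspec[OF SK(5) that] by (auto simp: T_def U_def)
    have cutdisj: "boundary E K \<inter> boundary E L = {}" if KL: "K \<in> \<K>" "L \<in> \<K>" "K \<noteq> L" for K L
    proof -
      have "K \<inter> L = {}" using SK(3) that by (auto simp: pairwise_def disjnt_def)
      show ?thesis
      proof (rule equals0I)
        fix e assume "e \<in> boundary E K \<inter> boundary E L"
        then obtain a b c d where "e = {a, b}" "a \<in> K" "b \<in> T" "e = {c, d}" "c \<in> L" "d \<in> T"
          using shape[OF KL(1)] shape[OF KL(2)] by (metis IntE)
        then show False
          using \<open>K \<inter> L = {}\<close> KT[OF KL(1)] by (auto simp: doubleton_eq_iff)
      qed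
    qed
    have "3 * card \<K> \<le> (\<Sum>K\<in>\<K>. card (boundary E K))"
      using sum_bounded_below[of \<K> 3 "\<lambda>K. card (boundary E K)"] cut3 by (simp add: mult.commute)
    also have "\<dots> = card (\<Union>K\<in>\<K>. boundary E K)"
      using SK(2) fincut cutdisj by (subst card_UN_disjoint) auto
    also have "\<dots> \<le> card (boundary E T)"
    proof (rule card_mono[OF fincut], safe)
      fix K e assume K: "K \<in> \<K>" and e: "e \<in> boundary E K"
      obtain a b where ab: "e = {a, b}" "a \<in> K" "b \<in> T" using shape[OF K e] by auto
      then have "e \<inter> T = {b}" using KT[OF K] by auto
      then show "e \<in> boundary E T" using e by (auto simp: boundary_def)
    qed
    finally have "3 * (card S + 2) \<le> card (boundary E T)" using SK(4) by simp
    moreover have "card {e \<in> E. e \<subseteq> T} \<ge> 1"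
    proof -
      have "{u, v} \<in> {e \<in> E. e \<subseteq> T}" using uv by (auto simp: T_def)
      then show ?thesis using finE by (auto simp: Suc_le_eq card_gt_0_iff)
    qed
    ultimately have False using sd[OF TV(1)] TV(2) by (simp add: boundary_def)
    then show ?thesis ..
  qed
qed

section \<open>Cuts and cocycles\<close>

lemma even_sum_sym_diff:
  fixes w :: "'a \<Rightarrow> int"
  assumes "finite A" "finite B"
  shows "even (sum w (sym_diff A B) + sum w A + sum w B)"
proof -
  have "sum w (sym_diff A B) = sum w (A - B) + sum w (B - A)"
    using assms by (intro sum.union_disjoint) auto
  moreover have "sum w A = sum w (A - B) + sum w (A \<inter> B)"
    using sum.Int_Diff[OF assms(1), of w B] by simp
  moreover have "sum w B = sum w (B - A) + sum w (A \<inter> B)"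
    using sum.Int_Diff[OF assms(2), of w A] by (simp add: Int_commute)
  ultimately show ?thesis by simp
qed

lemma even_card_sym_diff:
  assumes "finite A" "finite B"
  shows "even (card (sym_diff A B \<inter> S)) \<longleftrightarrow> (even (card (A \<inter> S)) \<longleftrightarrow> even (card (B \<inter> S)))"
proof -
  have "sym_diff A B \<inter> S = sym_diff (A \<inter> S) (B \<inter> S)" by auto
  then show ?thesis
    using even_sum_sym_diff[of "A \<inter> S" "B \<inter> S" "\<lambda>_. 1"] assms by auto
qed

lemma boundary_iff: "a \<noteq> b \<Longrightarrow> {a, b} \<in> boundary E X \<longleftrightarrow> {a, b} \<in> E \<and> (a \<in> X) \<noteq> (b \<in> X)"
  by (auto simp: boundary_def Int_insert_left)

lemma simple_graph_edgeE:
  assumes "simple_graph V E" "e \<in> E"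
  obtains a b where "e = {a, b}" "a \<noteq> b" "a \<in> V" "b \<in> V"
  using assms unfolding simple_graph_def card_2_iff by (metis insert_subset)

lemma connected_induct:
  assumes "graph_connected V E" "r \<in> V" "v \<in> V" "P r"
    and "\<And>x y. P x \<Longrightarrow> {x, y} \<in> E \<Longrightarrow> P y"
  shows "P v"
proof -
  have "(r, v) \<in> {(x, y). {x, y} \<in> E}\<^sup>*" using assms(1-3) by (auto simp: graph_connected_def)
  then show ?thesis by induction (use assms(4,5) in auto)
qed

lemma boundary_sym_diff:
  assumes "simple_graph V E"
  shows "sym_diff (boundary E A) (boundary E B) = boundary E (sym_diff A B)"
proof (rule set_eqI)
  fix e
  show "e \<in> sym_diff (boundary E A) (boundary E B) \<longleftrightarrow> e \<in> boundary E (sym_diff A B)"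
  proof (cases "e \<in> E")
    case True
    then obtain a b where "e = {a, b}" "a \<noteq> b" using simple_graph_edgeE[OF assms] by metis
    then show ?thesis by (auto simp: boundary_iff)
  qed (auto simp: boundary_def)
qed

text \<open>By connectedness a cut determines its sides. Complementary sides have the same boundary,
  so \<open>r\<close> is kept out of the side, whence the exponent.\<close>

lemma card_boundaries:
  assumes G: "simple_graph V E" and con: "graph_connected V E" and r: "r \<in> V"
  shows "2 ^ (card V - 1) \<le> card (boundary E ` Pow V)"
proof -
  have fin: "finite V" using G by (simp add: simple_graph_def)
  have "inj_on (boundary E) (Pow (V - {r}))"
  proof (rule inj_onI)
    fix A B assume AB: "A \<in> Pow (V - {r})" "B \<in> Pow (V - {r})" "boundary E A = boundary E B"
    have "v \<in> A \<longleftrightarrow> v \<in> B" if v: "v \<in> V" for v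
    proof (rule connected_induct[OF con r v])
      show "r \<in> A \<longleftrightarrow> r \<in> B" using AB by auto
      fix x y assume xy: "x \<in> A \<longleftrightarrow> x \<in> B" "{x, y} \<in> E"
      then have "x \<noteq> y" using G by (fastforce simp: simple_graph_def)
      then show "y \<in> A \<longleftrightarrow> y \<in> B"
        using xy AB(3) boundary_iff[of x y E A] boundary_iff[of x y E B] by auto
    qed
    then show "A = B" using AB by auto
  qed
  then have "card (boundary E ` Pow (V - {r})) = 2 ^ (card V - 1)"
    using fin r by (simp add: card_image card_Pow)
  moreover have "card (boundary E ` Pow (V - {r})) \<le> card (boundary E ` Pow V)"
    using fin by (intro card_mono) auto
  ultimately show ?thesis by simp
qed

text \<open>The weight is the edge multiplicity of a closed walk meeting \<open>Z\<close> an odd number of times.\<close>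
lemma non_boundary_weight:
  assumes G: "simple_graph V E" and con: "graph_connected V E" and Z: "Z \<subseteq> E" "Z \<notin> boundary E ` Pow V"
  shows "\<exists>w :: 'a set \<Rightarrow> int. (\<forall>A. even (sum w (boundary E A))) \<and> odd (sum w Z)"
proof (rule ccontr)
  assume no: "\<not> ?thesis"
  have finE: "finite E" using simple_graph_finite_edges[OF G] .
  then have finZ: "finite Z" using Z finite_subset by blast
  have finB: "finite (boundary E A)" for A using finE by (simp add: boundary_def)
  have "E \<noteq> {}"
  proof
    assume "E = {}"
    then have "Z = boundary E {}" using Z by (auto simp: boundary_def)
    then show False using Z(2) by auto
  qed
  then obtain r where r: "r \<in> V" using simple_graph_edgeE[OF G] by blast
  \<comment> \<open>Mod 2, \<open>w\<close> behaves like a walk from \<open>r\<close> to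
    \<open>v\<close>: it crosses a cut oddly iff the cut separates \<open>r\<close> from
    \<open>v\<close>.\<close>
  define P where "P v w \<longleftrightarrow> (\<forall>A. even (sum w (boundary E A) + of_bool (r \<in> A) + of_bool (v \<in> A)))"
    for v and w :: "'a set \<Rightarrow> int"
  have upd: "sum (\<lambda>x. w x + of_bool (x = e)) S = sum w S + of_bool (e \<in> S)"
    if "finite S" for w :: "'a set \<Rightarrow> int" and e S
    using that by (simp add: sum.distrib)
  have step: "P y (\<lambda>e. w e + of_bool (e = {x, y}))" if w: "P x w" and e: "{x, y} \<in> E" for x y w
    unfolding P_def
  proof
    fix A
    have "x \<noteq> y" using G e by (fastforce simp: simple_graph_def)
    then show "even (sum (\<lambda>e. w e + of_bool (e = {x, y})) (boundary E A) + of_bool (r \<in> A) + of_bool (y \<in> A))"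
      using w[unfolded P_def, rule_format, of A] e by (auto simp: upd[OF finB] boundary_iff)
  qed
  have "\<exists>w. P v w" if v: "v \<in> V" for v
  proof (rule connected_induct[OF con r v])
    have "P r (\<lambda>_. 0)" by (auto simp: P_def)
    then show "\<exists>w. P r w" by blast
    show "\<exists>w. P y w" if "\<exists>w. P x w" "{x, y} \<in> E" for x y using that step by blast
  qed
  then obtain W where W: "\<And>v. v \<in> V \<Longrightarrow> P v (W v)" by metis
  \<comment> \<open>If every closed walk met \<open>Z\<close> evenly, the parity of \<open>Z\<close>
    along a walk from \<open>r\<close> would depend only on the end of the walk; the vertices of odd
    parity would form one side of \<open>Z\<close> as a cut.\<close>
  define A where "A = {v \<in> V. odd (sum (W v) Z)}"
  have "e \<in> Z \<longleftrightarrow> e \<in> boundary E A" if eE: "e \<in> E" for e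
  proof -
    obtain a b where ab: "e = {a, b}" "a \<noteq> b" "a \<in> V" "b \<in> V" using simple_graph_edgeE[OF G eE] .
    \<comment> \<open>The closed walk from \<open>r\<close> to \<open>a\<close>, over
      \<open>e\<close> to \<open>b\<close>, and back to \<open>r\<close>.\<close>
    define w where "w x = W a x + W b x + of_bool (x = e)" for x
    have s: "sum w S = sum (W a) S + sum (W b) S + of_bool (e \<in> S)" if "finite S" for S
      using upd[OF that, of "\<lambda>x. W a x + W b x" e] by (simp add: w_def sum.distrib)
    have "even (sum w (boundary E X))" for X
      using W[OF ab(3), unfolded P_def, rule_format, of X] W[OF ab(4), unfolded P_def, rule_format, of X] ab(1,2) eE
      by (auto simp: s[OF finB] boundary_iff)
    then have "even (sum w Z)" using no by blast
    then have "e \<in> Z \<longleftrightarrow> (a \<in> A) \<noteq> (b \<in> A)" using ab(3,4) by (auto simp: s[OF finZ] A_def)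
    then show ?thesis using ab eE by (simp add: boundary_iff)
  qed
  then have "Z = boundary E A" using Z(1) by (auto simp: boundary_def)
  moreover have "A \<subseteq> V" by (auto simp: A_def)
  ultimately show False using Z(2) by blast
qed

section \<open>Incidences of faces and edges, and mod 2 cocycles\<close>

locale triangulation =
  fixes V :: "'a set" and E :: "'a set set" and F :: "'f set" and tri :: "'f \<Rightarrow> 'a set"
  assumes tri: "surface_triangulation V E F tri"
begin

definition sides :: "'f \<Rightarrow> 'a set set" where "sides f = {e \<in> E. e \<subseteq> tri f}"
definition faces :: "'a set \<Rightarrow> 'f set" where "faces e = {f \<in> F. e \<subseteq> tri f}"
text \<open>Dual edges are plain pairs of faces, so parallel ones would merge;
  \<open>inj_faces\<close> rules this out later.\<close>

definition dual :: "'f set set" where "dual = faces ` E"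

lemma graph: "simple_graph V E" and con: "graph_connected V E" and finF: "finite F"
  and tri_sub: "f \<in> F \<Longrightarrow> tri f \<subseteq> V" and tri_card: "f \<in> F \<Longrightarrow> card (tri f) = 3"
  and tri_edge: "f \<in> F \<Longrightarrow> x \<in> tri f \<Longrightarrow> y \<in> tri f \<Longrightarrow> x \<noteq> y \<Longrightarrow> {x, y} \<in> E"
  and card_faces: "e \<in> E \<Longrightarrow> card (faces e) = 2"
  and vertex_face: "v \<in> V \<Longrightarrow> \<exists>f\<in>F. v \<in> tri f"
  and link: "v \<in> V \<Longrightarrow> f \<in> F \<Longrightarrow> g \<in> F \<Longrightarrow> v \<in> tri f \<Longrightarrow> v \<in> tri g \<Longrightarrow> (f, g) \<in> (face_adj_at v F tri)\<^sup>*"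
  using tri by (auto simp: surface_triangulation_def faces_def)

lemma finV: "finite V" and finE: "finite E"
  using graph simple_graph_finite_edges by (auto simp: simple_graph_def)

lemma fin_tri: "f \<in> F \<Longrightarrow> finite (tri f)"
  using tri_sub finV finite_subset by blast

lemma fin_sides: "finite (sides f)"
  using finE by (simp add: sides_def)

lemma fin_faces: "finite (faces e)"
  using finF by (simp add: faces_def)

lemma faces_iff: "f \<in> F \<Longrightarrow> e \<in> E \<Longrightarrow> f \<in> faces e \<longleftrightarrow> e \<in> sides f"
  by (auto simp: faces_def sides_def)

lemma sides_eq: "f \<in> F \<Longrightarrow> sides f = {e. e \<subseteq> tri f \<and> card e = 2}"
  using graph tri_edge by (auto simp: sides_def simple_graph_def card_2_iff)

lemma card_sides: "f \<in> F \<Longrightarrow> card (sides f) = 3"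
  using n_subsets[OF fin_tri, of f 2] tri_card by (simp add: sides_eq numeral_3_eq_3 numeral_2_eq_2)

lemma degree_sides:
  assumes "f \<in> F" shows "degree (sides f) v = (if v \<in> tri f then 2 else 0)"
proof (cases "v \<in> tri f")
  case True
  have "{e \<in> sides f. v \<in> e} = (\<lambda>u. {v, u}) ` (tri f - {v})"
    using True by (auto simp: sides_eq[OF assms] card_2_iff)
  moreover have "inj_on (\<lambda>u. {v, u}) (tri f - {v})" by (auto simp: inj_on_def doubleton_eq_iff)
  ultimately show ?thesis using True tri_card[OF assms] fin_tri[OF assms] by (simp add: degree_def card_image)
next
  case False
  then have "{e \<in> sides f. v \<in> e} = {}" by (auto simp: sides_def)
  then have "degree (sides f) v = 0" by (simp only: degree_def card.empty)
  then show ?thesis using False by simp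
qed

text \<open>This serves as induction over dual adjacency. Closure passes round each vertex because
  its link is connected, and on to the next vertex because every edge lies on a face.\<close>

lemma dual_closed_eq:
  assumes X: "X \<subseteq> F" "X \<noteq> {}"
    and cl: "\<And>f g e. f \<in> X \<Longrightarrow> e \<in> E \<Longrightarrow> f \<in> faces e \<Longrightarrow> g \<in> faces e \<Longrightarrow> g \<in> X"
  shows "X = F"
proof -
  obtain f0 where f0: "f0 \<in> X" using X by auto
  obtain v0 where v0: "v0 \<in> tri f0" using tri_card[of f0] f0 X by fastforce
  have v0V: "v0 \<in> V" using v0 f0 X tri_sub by blast
  have around: "g \<in> X" if f: "f \<in> X" "v \<in> tri f" and g: "g \<in> F" "v \<in> tri g" for f g v
  proof -
    have "(f, g) \<in> (face_adj_at v F tri)\<^sup>*" using link[of v f g] f g X tri_sub by blast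
    then show ?thesis
    proof induction
      case base
      then show ?case using f by simp
    next
      case (step a b)
      then obtain u where u: "a \<in> F" "b \<in> F" "u \<noteq> v" "{v, u} \<subseteq> tri a" "{v, u} \<subseteq> tri b" by (auto simp: face_adj_at_def)
      then have "{v, u} \<in> E" using tri_edge[of a v u] by auto
      then show ?case using cl[OF step.IH, of "{v, u}" b] u by (auto simp: faces_def)
    qed
  qed
  have "\<exists>f\<in>X. v \<in> tri f" if v: "v \<in> V" for v
  proof (rule connected_induct[OF con v0V v])
    show "\<exists>f\<in>X. v0 \<in> tri f" using f0 v0 by auto
    fix x y assume xy: "\<exists>f\<in>X. x \<in> tri f" "{x, y} \<in> E"
    then have "faces {x, y} \<noteq> {}" using card_faces by fastforce
    then obtain g where "g \<in> F" "x \<in> tri g" "y \<in> tri g" by (auto simp: faces_def)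
    then show "\<exists>f\<in>X. y \<in> tri f" using xy around by blast
  qed
  moreover have "tri g \<inter> V \<noteq> {}" if "g \<in> F" for g
  proof -
    have "tri g \<noteq> {}" using tri_card[OF that] by (metis card.empty zero_neq_numeral)
    then show ?thesis using tri_sub[OF that] by auto
  qed
  ultimately show ?thesis using around X by blast
qed

lemma sum_faces_sides:
  assumes "X \<subseteq> F" "Y \<subseteq> E"
  shows "(\<Sum>f\<in>X. card (Y \<inter> sides f)) = (\<Sum>e\<in>Y. card (faces e \<inter> X))"
proof -
  have fin: "finite X" "finite Y" using assms finF finE finite_subset by blast+
  have "(\<Sum>f\<in>X. card (Y \<inter> sides f)) = (\<Sum>f\<in>X. \<Sum>e\<in>Y. of_bool (f \<in> faces e))"
    using assms faces_iff fin by (intro sum.cong) (auto simp: Int_def subset_eq intro!: arg_cong[of _ _ card])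
  also have "\<dots> = (\<Sum>e\<in>Y. \<Sum>f\<in>X. of_bool (f \<in> faces e))" by (rule sum.swap)
  also have "\<dots> = (\<Sum>e\<in>Y. card (faces e \<inter> X))"
    using fin by (intro sum.cong) (auto simp: Int_commute)
  finally show ?thesis .
qed

lemma three_faces: "3 * card F = 2 * card E"
proof -
  have "(\<Sum>f\<in>F. card (E \<inter> sides f)) = (\<Sum>e\<in>E. card (faces e \<inter> F))" by (rule sum_faces_sides) auto
  moreover have "E \<inter> sides f = sides f" "faces e \<inter> F = faces e" for e f by (auto simp: sides_def faces_def)
  ultimately show ?thesis using card_sides card_faces by simp
qed

lemma boundary_even:
  assumes f: "f \<in> F" shows "even (card (boundary E A \<inter> sides f))"
proof -
  let ?X = "A \<inter> tri f"
  have "card e = 2" if "e \<in> sides f" for e using that sides_eq[OF f] by auto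
  then have "(\<Sum>v\<in>?X. degree (sides f) v) = card {e \<in> sides f. card (e \<inter> ?X) = 1} + 2 * card {e \<in> sides f. e \<subseteq> ?X}"
    using sum_degree[OF fin_sides, of ?X f] fin_tri[OF f] by (simp add: boundary_def)
  moreover have "{e \<in> sides f. card (e \<inter> ?X) = 1} = boundary E A \<inter> sides f"
  proof -
    have "e \<inter> ?X = e \<inter> A" if "e \<in> sides f" for e using that by (auto simp: sides_def)
    then show ?thesis by (auto simp: boundary_def sides_def)
  qed
  moreover have "(\<Sum>v\<in>?X. degree (sides f) v) = 2 * card ?X" using degree_sides[OF f] by simp
  ultimately have "2 * card ?X = card (boundary E A \<inter> sides f) + 2 * card {e \<in> sides f. e \<subseteq> ?X}" by simp
  moreover have "even a" if "2 * x = a + 2 * b" for x a b :: nat using that by presburger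
  ultimately show ?thesis by blast
qed

text \<open>Going round a vertex, one enters \<open>X\<close> as often as one leaves it, so evenly
  many edges there separate \<open>X\<close> from its complement. A lone separating edge would
  violate this at its end \<open>a\<close>. The proof counts: each face of \<open>X\<close> has 0 or
  2 sides at \<open>a\<close>.\<close>

lemma bridgeless_faces:
  assumes X: "X \<subseteq> F" shows "card {e \<in> E. card (faces e \<inter> X) = 1} \<noteq> 1"
proof
  assume "card {e \<in> E. card (faces e \<inter> X) = 1} = 1"
  then obtain e where e: "{e \<in> E. card (faces e \<inter> X) = 1} = {e}" by (auto simp: card_1_singleton_iff)
  then have eE: "e \<in> E" "card (faces e \<inter> X) = 1" by auto
  obtain a b where ab: "e = {a, b}" using simple_graph_edgeE[OF graph eE(1)] by metis
  let ?Y = "{e \<in> E. a \<in> e}"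
  have eY: "e \<in> ?Y" using eE ab by auto
  have finY: "finite ?Y" using finE by simp
  have "even (card (?Y \<inter> sides f))" if "f \<in> X" for f
  proof -
    have "?Y \<inter> sides f = {e \<in> sides f. a \<in> e}" by (auto simp: sides_def)
    then show ?thesis using degree_sides[of f a] X that by (auto simp: degree_def)
  qed
  then have "even (\<Sum>f\<in>X. card (?Y \<inter> sides f))" by (simp add: dvd_sum)
  then have "even (\<Sum>e\<in>?Y. card (faces e \<inter> X))" using sum_faces_sides[OF X, of ?Y] by auto
  moreover have "(\<Sum>e\<in>?Y. card (faces e \<inter> X)) = 1 + (\<Sum>x\<in>?Y - {e}. card (faces x \<inter> X))"
    using sum.remove[OF finY eY, of "\<lambda>e. card (faces e \<inter> X)"] eE by simp
  moreover have "even (\<Sum>x\<in>?Y - {e}. card (faces x \<inter> X))"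
  proof (rule dvd_sum)
    fix x assume x: "x \<in> ?Y - {e}"
    then have "card (faces x \<inter> X) \<le> 2" "card (faces x \<inter> X) \<noteq> 1"
      using card_faces[of x] card_mono[OF fin_faces, of "faces x \<inter> X" x] e by auto
    then have "card (faces x \<inter> X) = 0 \<or> card (faces x \<inter> X) = 2" by linarith
    then show "even (card (faces x \<inter> X))" by auto
  qed
  ultimately show False by simp
qed

text \<open>As sets of dual edges, these are the subgraphs with all degrees even.\<close>

definition cocycles :: "'a set set set" where
  "cocycles = {Z. Z \<subseteq> E \<and> (\<forall>f\<in>F. even (card (Z \<inter> sides f)))}"

text \<open>The map from edge sets to face parities has rank at least \<open>card F - 1\<close>:
  dual paths from \<open>f0\<close> realise any prescribed parities off \<open>f0\<close>. Adding
  these realisations to the cocycles yields distinct edge sets.\<close>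

lemma card_cocycles:
  assumes f0: "f0 \<in> F" shows "card cocycles * 2 ^ (card F - 1) \<le> 2 ^ card E"
proof -
  have finsub: "finite Y" if "Y \<subseteq> E" for Y using that finE finite_subset by blast
  \<comment> \<open>\<open>Y\<close> stands for a dual path from \<open>f0\<close> to
    \<open>g\<close>, odd just at its two ends; for \<open>g = f0\<close> no face is odd.\<close>
  define Q where "Q g Y \<longleftrightarrow> Y \<subseteq> E \<and> (\<forall>f\<in>F. odd (card (Y \<inter> sides f)) \<longleftrightarrow> (f = f0) \<noteq> (f = g))" for g Y
  have conn: "{g \<in> F. \<exists>Y. Q g Y} = F"
  proof (rule dual_closed_eq)
    have "Q f0 {}" by (auto simp: Q_def)
    then show "{g \<in> F. \<exists>Y. Q g Y} \<noteq> {}" using f0 by auto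
    fix f g e assume f: "f \<in> {g \<in> F. \<exists>Y. Q g Y}" and e: "e \<in> E" "f \<in> faces e" "g \<in> faces e"
    have gF: "g \<in> F" "f \<in> F" using e by (auto simp: faces_def)
    show "g \<in> {g \<in> F. \<exists>Y. Q g Y}"
    proof (cases "g = f")
      case True then show ?thesis using f by simp
    next
      case False
      obtain Y where Y: "Q f Y" using f by auto
      have fe: "faces e = {f, g}" using card_faces[OF e(1)] e False fin_faces[of e]
        by (metis card_2_iff doubleton_eq_iff insertE singletonD)
      have "odd (card ({e} \<inter> sides h)) \<longleftrightarrow> h = f \<or> h = g" if h: "h \<in> F" for h
        using faces_iff[OF h e(1)] fe by (auto simp: Int_insert_left)
      then have "Q g (sym_diff Y {e})"
        using Y e(1) False even_card_sym_diff[of Y "{e}"] finsub[of Y] by (auto simp: Q_def)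
      then show ?thesis using gF by auto
    qed
  qed auto
  have ex: "\<exists>X. X \<subseteq> E \<and> (\<forall>f\<in>F - {f0}. odd (card (X \<inter> sides f)) \<longleftrightarrow> f \<in> Y)" if Y: "Y \<subseteq> F - {f0}" for Y
  proof -
    have "finite Y" using Y finF finite_subset by blast
    then show ?thesis using Y
    proof (induction Y)
      case empty
      show ?case by (intro exI[of _ "{}"]) auto
    next
      case (insert g Y)
      then obtain X where X: "X \<subseteq> E" "\<forall>f\<in>F - {f0}. odd (card (X \<inter> sides f)) \<longleftrightarrow> f \<in> Y" by auto
      obtain X' where X': "Q g X'" using conn insert.prems by auto
      show ?case
        using X X' insert.hyps insert.prems even_card_sym_diff[of X X'] finsub[of X] finsub[of X']
        by (intro exI[of _ "sym_diff X X'"]) (auto simp: Q_def)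
    qed
  qed
  then obtain \<sigma> where \<sigma>: "\<And>Y. Y \<subseteq> F - {f0} \<Longrightarrow> \<sigma> Y \<subseteq> E"
    "\<And>Y f. Y \<subseteq> F - {f0} \<Longrightarrow> f \<in> F - {f0} \<Longrightarrow> odd (card (\<sigma> Y \<inter> sides f)) \<longleftrightarrow> f \<in> Y" by metis
  define h where "h = (\<lambda>(Z, Y). sym_diff Z (\<sigma> Y))"
  have "inj_on h (cocycles \<times> Pow (F - {f0}))"
  proof (rule inj_onI, clarify)
    fix Z Y Z' Y' assume a: "Z \<in> cocycles" "Z' \<in> cocycles" "Y \<subseteq> F - {f0}" "Y' \<subseteq> F - {f0}" "h (Z, Y) = h (Z', Y')"
    have par: "odd (card (h (Z, Y) \<inter> sides f)) \<longleftrightarrow> f \<in> Y" if "Z \<in> cocycles" "Y \<subseteq> F - {f0}" "f \<in> F - {f0}" for Z Y f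
      using that \<sigma>[OF that(2)] even_card_sym_diff[of Z "\<sigma> Y" "sides f"] finsub
      by (auto simp: h_def cocycles_def)
    have "f \<in> Y \<longleftrightarrow> f \<in> Y'" if "f \<in> F - {f0}" for f
      using par[OF a(1,3) that] par[OF a(2,4) that] a(5) by simp
    then have YY: "Y = Y'" using a by blast
    moreover have "Z = Z'" using a(5) unfolding h_def YY by auto
    ultimately show "Z = Z' \<and> Y = Y'" by simp
  qed
  moreover have "h ` (cocycles \<times> Pow (F - {f0})) \<subseteq> Pow E"
  proof (rule image_subsetI)
    fix x assume "x \<in> cocycles \<times> Pow (F - {f0})"
    then obtain Z Y where "x = (Z, Y)" "Z \<subseteq> E" "Y \<subseteq> F - {f0}" by (auto simp: cocycles_def)
    then show "h x \<in> Pow E" using \<sigma>(1)[of Y] by (auto simp: h_def)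
  qed
  ultimately have "card (cocycles \<times> Pow (F - {f0})) \<le> card (Pow E)"
    using finE by (intro card_inj_on_le[of h]) auto
  then show ?thesis using finF finE f0 by (simp add: card_cartesian_product card_Pow)
qed

end

section \<open>Triangulations of the projective plane\<close>

lemma ex_perfect_matching:
  assumes "simple_graph V E" "V \<noteq> {}" "\<And>v. v \<in> V \<Longrightarrow> degree E v = 3"
    and "\<And>X. X \<subseteq> V \<Longrightarrow> card (boundary E X) \<noteq> 1"
  shows "\<exists>m. perfect_matching V E m"
proof -
  obtain r where "r \<in> V" using assms(2) by auto
  then have "card {e \<in> E. r \<in> e} \<noteq> 0" using assms(3) by (simp add: degree_def)
  then have "{e \<in> E. r \<in> e} \<noteq> {}" by (metis card.empty)
  then obtain e where "e \<in> E" by auto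
  then obtain a b where "{a, b} \<in> E" using simple_graph_edgeE[OF assms(1)] by metis
  then show ?thesis using cubic_edge_in_perfect_matching[OF assms(1,3,4)] by blast
qed

text \<open>If parity \<open>b\<close> never occurred, all near matchings would agree with
  \<open>M\<close>, and \<open>w\<close> would have a potential. Summed over \<open>Z\<close>, each
  vertex value occurs \<open>degree Z v\<close> times, so \<open>w\<close> would be even on
  \<open>Z\<close>.\<close>

theorem near_matching_parity:
  fixes w :: "'a set \<Rightarrow> int"
  assumes G: "simple_graph V E" and con: "graph_connected V E" and ne: "V \<noteq> {}"
    and cubic: "\<And>v. v \<in> V \<Longrightarrow> degree E v = 3"
    and bridgeless: "\<And>X. X \<subseteq> V \<Longrightarrow> card (boundary E X) \<noteq> 1"
    and Z: "Z \<subseteq> E" "\<And>v. v \<in> V \<Longrightarrow> even (degree Z v)" "odd (sum w Z)"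
  shows "\<exists>J. near_matching V E J \<and> (even (sum w J) \<longleftrightarrow> b)"
proof (rule ccontr)
  assume no: "\<not> ?thesis"
  obtain m where m: "perfect_matching V E m" using ex_perfect_matching[OF G ne cubic bridgeless] by blast
  interpret matched_graph V E m by (rule matched_graph.intro[OF G m])
  have "near_matching V E M" using M_sub degree_M by (auto simp: near_matching_def)
  then interpret weighted_matched_graph V E m w
    using no by unfold_locales auto
  obtain p where p: "balanced w p E = E"
    using ex_potential[OF con cubic_edge_in_perfect_matching[OF G cubic bridgeless]] by blast
  have finZ: "finite Z" using Z(1) finE finite_subset by blast
  have sub: "e \<subseteq> V" if "e \<in> Z" for e using that Z(1) G by (auto simp: simple_graph_def)
  have "(\<Sum>e\<in>Z. sum p e) = (\<Sum>e\<in>Z. \<Sum>v\<in>V. p v * of_bool (v \<in> e))"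
  proof (rule sum.cong[OF refl])
    fix e assume "e \<in> Z"
    then have "e = V \<inter> e" using sub by auto
    then show "sum p e = (\<Sum>v\<in>V. p v * of_bool (v \<in> e))"
      using sum.inter_restrict[OF finV, of p e] by (simp add: of_bool_def if_distrib cong: if_cong)
  qed
  also have "\<dots> = (\<Sum>v\<in>V. \<Sum>e\<in>Z. p v * of_bool (v \<in> e))" by (rule sum.swap)
  also have "\<dots> = (\<Sum>v\<in>V. p v * int (degree Z v))"
    using finZ by (simp add: sum_distrib_left[symmetric] degree_def Collect_conj_eq Int_commute)
  finally have "even (\<Sum>e\<in>Z. sum p e)" using Z(2) by (auto intro!: dvd_sum)
  moreover have "even (\<Sum>e\<in>Z. w e + sum p e)"
    using p Z(1) by (intro dvd_sum) (auto simp: balanced_def)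
  ultimately show False using Z(3) by (simp add: sum.distrib)
qed

locale projective_triangulation = triangulation +
  assumes euler: "int (card V) - int (card E) + int (card F) = 1"
begin

lemma V_ne: "V \<noteq> {}"
proof
  assume V: "V = {}"
  then have "E = {}" using simple_graph_edgeE[OF graph] by blast
  moreover have "F = {}" using tri_sub tri_card V by fastforce
  ultimately show False using euler V by simp
qed

lemma F_ne: "F \<noteq> {}"
  using V_ne vertex_face by blast

text \<open>Two edges with the same two faces force these faces to have equal corners and hence to
  be all of \<open>F\<close>. Two triangles glued along their rims form a sphere, with 3 - 3 + 2 =
  2.\<close>

lemma inj_faces: "inj_on faces E"
proof (rule inj_onI, rule ccontr)
  fix e e' assume e: "e \<in> E" "e' \<in> E" "faces e = faces e'" "e \<noteq> e'"
  obtain f g where fg: "faces e = {f, g}" "f \<noteq> g" using card_faces[OF e(1)] by (auto simp: card_2_iff)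
  then have F: "f \<in> F" "g \<in> F" by (auto simp: faces_def)
  have c2: "card e = 2" "card e' = 2" "finite e" "finite e'"
    using graph e(1,2) by (auto simp: simple_graph_def intro: card_ge_0_finite)
  have tri_un: "tri h = e \<union> e'" if h: "h \<in> {f, g}" for h
  proof -
    have hF: "h \<in> F" and sub: "e \<union> e' \<subseteq> tri h" using h fg e(3) F by (auto simp: faces_def)
    have "\<not> e' \<subseteq> e" using card_subset_eq[OF c2(3)] c2 e(4) by auto
    then have "e \<subset> e \<union> e'" by auto
    then have "card e < card (e \<union> e')" using c2 by (intro psubset_card_mono) auto
    then have "card (tri h) \<le> card (e \<union> e')" using tri_card[OF hF] c2(1) by simp
    then show ?thesis using card_seteq[OF fin_tri[OF hF] sub] by simp
  qed
  have teq: "tri f = tri g" using tri_un by auto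
  have XF: "{f, g} = F"
  proof (rule dual_closed_eq)
    fix a b x assume x: "a \<in> {f, g}" "x \<in> E" "a \<in> faces x" "b \<in> faces x"
    then have "{f, g} \<subseteq> faces x" using F teq by (auto simp: faces_def)
    then have "{f, g} = faces x"
      using card_faces[OF x(2)] fg(2) by (intro card_subset_eq[OF fin_faces]) auto
    then show "b \<in> {f, g}" using x by simp
  qed (use F in auto)
  have "V = tri f"
    using vertex_face tri_sub[OF F(1)] teq unfolding XF[symmetric] by blast
  then have "card V = 3" "card F = 2" using tri_card[OF F(1)] fg(2) by (auto simp: XF[symmetric])
  moreover have "card E = 3" using three_faces \<open>card F = 2\<close> by simp
  ultimately show False using euler by simp
qed

lemma card_V: "card F + card V = Suc (card E)"
  using euler by linarith

section \<open>The dual as a connected cubic bridgeless graph\<close>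

lemma dual_graph: "simple_graph F dual"
  using finF card_faces by (auto simp: simple_graph_def dual_def faces_def)

lemma dual_connected: "graph_connected F dual"
  unfolding graph_connected_def
proof (intro ballI)
  fix u v assume uv: "u \<in> F" "v \<in> F"
  let ?R = "{(x, y). {x, y} \<in> dual}\<^sup>*"
  have "{x \<in> F. (u, x) \<in> ?R} = F"
  proof (rule dual_closed_eq)
    show "{x \<in> F. (u, x) \<in> ?R} \<noteq> {}" using uv by auto
    fix f g e assume f: "f \<in> {x \<in> F. (u, x) \<in> ?R}" and e: "e \<in> E" "f \<in> faces e" "g \<in> faces e"
    have "g = f \<or> faces e = {f, g}"
      using card_seteq[OF fin_faces, of "{f, g}" e] card_faces[OF e(1)] e by (cases "g = f") auto
    then have "g = f \<or> {f, g} \<in> dual" using e(1) by (auto simp: dual_def)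
    then have "(u, g) \<in> ?R" using f by (auto intro: rtrancl_into_rtrancl)
    then show "g \<in> {x \<in> F. (u, x) \<in> ?R}" using e(3) by (auto simp: faces_def)
  qed auto
  then show "(u, v) \<in> ?R" using uv by blast
qed

lemma degree_dual:
  assumes "f \<in> F" "Y \<subseteq> E" shows "degree (faces ` Y) f = card (Y \<inter> sides f)"
proof -
  have "{x \<in> faces ` Y. f \<in> x} = faces ` (Y \<inter> sides f)"
    using assms faces_iff[OF assms(1)] by blast
  moreover have "inj_on faces (Y \<inter> sides f)" using inj_faces assms(2) by (auto intro: inj_on_subset)
  ultimately show ?thesis by (simp add: degree_def card_image)
qed

lemma dual_cubic: "f \<in> F \<Longrightarrow> degree dual f = 3"
proof -
  assume f: "f \<in> F"
  have "E \<inter> sides f = sides f" by (auto simp: sides_def)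
  then show ?thesis using degree_dual[OF f, of E] card_sides[OF f] by (simp add: dual_def)
qed

lemma dual_bridgeless:
  assumes "X \<subseteq> F" shows "card (boundary dual X) \<noteq> 1"
proof -
  have "boundary dual X = faces ` {e \<in> E. card (faces e \<inter> X) = 1}"
    by (auto simp: boundary_def dual_def)
  moreover have "inj_on faces {e \<in> E. card (faces e \<inter> X) = 1}"
    using inj_faces by (auto intro: inj_on_subset)
  ultimately show ?thesis using bridgeless_faces[OF assms] by (simp add: card_image)
qed

section \<open>Cuts among the cocycles\<close>

lemma boundary_cocycle: "boundary E A \<in> cocycles"
  using boundary_even by (auto simp: cocycles_def boundary_def)

text \<open>Euler's formula turns the bound \<open>2 ^ (card E - card F + 1)\<close> for cocycles
  into \<open>2 ^ card V\<close>, against at least \<open>2 ^ (card V - 1)\<close> cuts.\<close>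

lemma card_cocycles_le: "card cocycles \<le> 2 * card (boundary E ` Pow V)"
proof -
  obtain r f0 where r: "r \<in> V" "f0 \<in> F" using V_ne F_ne by auto
  then have pos: "card V > 0" "card F > 0" using finV finF by (auto simp: card_gt_0_iff)
  have "card E = card V + (card F - 1)" using card_V pos by simp
  then have "card cocycles * 2 ^ (card F - 1) \<le> 2 ^ card V * 2 ^ (card F - 1)"
    using card_cocycles[OF r(2)] by (simp add: power_add)
  then have "card cocycles \<le> 2 ^ card V" by simp
  also have "\<dots> = 2 * 2 ^ (card V - 1)" using pos by (simp add: power_eq_if)
  also have "\<dots> \<le> 2 * card (boundary E ` Pow V)" using card_boundaries[OF graph con r(1)] by simp
  finally show ?thesis .
qed

text \<open>The boundaries have index at most two in the cocycles: this is \<open>H\<^sup>1(P\<^sup>2; Z/2) = Z/2\<close>.\<close>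
lemma sym_diff_boundary:
  assumes "Z \<in> cocycles" "Z' \<in> cocycles" "Z \<notin> boundary E ` Pow V" "Z' \<notin> boundary E ` Pow V"
  shows "sym_diff Z Z' \<in> boundary E ` Pow V"
proof (rule ccontr)
  assume no: "sym_diff Z Z' \<notin> boundary E ` Pow V"
  let ?B = "boundary E ` Pow V"
  \<comment> \<open>The cuts, their coset by \<open>Z\<close>, and \<open>Z'\<close> outside both
    would make \<open>2 * card ?B + 1\<close> cocycles.\<close>
  let ?C = "(\<lambda>X. sym_diff Z X) ` ?B"
  have inv: "sym_diff Z (sym_diff Z X) = X" for X by auto
  have finB: "finite ?B" using finV by simp
  have "inj_on (\<lambda>X. sym_diff Z X) ?B" by (rule inj_on_inverseI[of _ "\<lambda>X. sym_diff Z X"]) (rule inv)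
  then have cC: "card ?C = card ?B" by (rule card_image)
  have BC: "?B \<inter> ?C = {}"
  proof (rule equals0I)
    fix X assume "X \<in> ?B \<inter> ?C"
    then obtain A B where AB: "A \<subseteq> V" "B \<subseteq> V" "boundary E A = sym_diff Z (boundary E B)" by auto
    then have "Z = sym_diff (boundary E A) (boundary E B)" by auto
    then have "Z = boundary E (sym_diff A B)" using boundary_sym_diff[OF graph] by simp
    then show False using assms(3) AB(1,2) by blast
  qed
  have Z'n: "Z' \<notin> ?B \<union> ?C"
  proof
    assume "Z' \<in> ?B \<union> ?C"
    then obtain X where "X \<in> ?B" "Z' = sym_diff Z X" using assms(4) by blast
    then show False using no inv by simp
  qed
  have finsub: "finite X" if "X \<subseteq> E" for X using that finE finite_subset by blast
  have "sym_diff Z X \<in> cocycles" if "X \<in> cocycles" for X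
    using assms(1) that even_card_sym_diff[of Z X] finsub by (auto simp: cocycles_def)
  then have sub: "insert Z' (?B \<union> ?C) \<subseteq> cocycles" using assms(2) boundary_cocycle by auto
  have "finite cocycles" using finE by (auto simp: cocycles_def intro: finite_subset[of _ "Pow E"])
  then have "card (insert Z' (?B \<union> ?C)) \<le> card cocycles" using sub by (rule card_mono)
  moreover have "card (insert Z' (?B \<union> ?C)) = Suc (2 * card ?B)"
    using Z'n finB BC cC by (simp add: card_Un_disjoint)
  ultimately show False using card_cocycles_le by simp
qed

text \<open>A face with 1 or 3 sides in \<open>T\<close> leaves 2 or 0 for the complement. The 3
  added in the bound is the surplus 2 of the centre \<open>c\<close>, times 3/2.\<close>

lemma near_matching_complement:
  assumes J: "near_matching F dual J" and T: "T = {e \<in> E. faces e \<in> J}"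
  shows "E - T \<in> cocycles" and "3 * card T \<le> card E + 3"
proof -
  have TE: "T \<subseteq> E" using T by auto
  have JT: "J = faces ` T" using J T by (auto simp: near_matching_def dual_def)
  obtain c where c: "\<And>f. f \<in> F \<Longrightarrow> card (T \<inter> sides f) = 1 \<or> f = c \<and> card (T \<inter> sides f) = 3"
    using J degree_dual[OF _ TE] unfolding near_matching_def JT by metis
  have "even (card ((E - T) \<inter> sides f))" if f: "f \<in> F" for f
  proof -
    have "(E - T) \<inter> sides f = sides f - T \<inter> sides f" by (auto simp: sides_def)
    then have "card ((E - T) \<inter> sides f) = 3 - card (T \<inter> sides f)"
      using card_sides[OF f] fin_sides[of f] by (simp add: card_Diff_subset)
    then show ?thesis using c[OF f] by auto
  qed
  then show "E - T \<in> cocycles" by (auto simp: cocycles_def)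
  have "2 * card T = (\<Sum>e\<in>T. card (faces e \<inter> F))"
  proof -
    have "faces e \<inter> F = faces e" for e by (auto simp: faces_def)
    then show ?thesis using TE card_faces by (simp add: subset_eq)
  qed
  also have "\<dots> = (\<Sum>f\<in>F. card (T \<inter> sides f))" using sum_faces_sides[OF order_refl TE] by simp
  also have "\<dots> \<le> (\<Sum>f\<in>F. 1 + (if f = c then 2 else 0))" by (rule sum_mono) (use c in fastforce)
  also have "\<dots> = card F + (\<Sum>f\<in>F. if f = c then 2 else 0)" by (simp only: sum.distrib card_eq_sum)
  also have "\<dots> \<le> card F + 2" using finF by simp
  finally show "3 * card T \<le> card E + 3" using three_faces by simp
qed

text \<open>The parity asked of \<open>J\<close> is that of \<open>E\<close>, so that the complement
  has even weight. A cocycle that is not a cut differs from \<open>Z\<close> by a cut, so its weight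
  would be odd.\<close>

lemma ex_near_matching_boundary:
  "\<exists>J. near_matching F dual J \<and> E - {e \<in> E. faces e \<in> J} \<in> boundary E ` Pow V"
proof (cases "cocycles \<subseteq> boundary E ` Pow V")
  \<comment> \<open>Only an upper bound for the index of the cuts has been shown, so the case that
    every cocycle is a cut is settled apart; any perfect matching of the dual serves there.\<close>
  case True
  obtain m where m: "perfect_matching F dual m"
    using ex_perfect_matching[OF dual_graph F_ne dual_cubic dual_bridgeless] by blast
  interpret D: matched_graph F dual m by (rule matched_graph.intro[OF dual_graph m])
  have nm: "near_matching F dual D.M" using D.M_sub D.degree_M by (auto simp: near_matching_def)
  show ?thesis using nm subsetD[OF True near_matching_complement(1)[OF nm refl]] by blast
next
  case False
  then obtain Z where Z: "Z \<in> cocycles" "Z \<notin> boundary E ` Pow V" by auto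
  have ZE: "Z \<subseteq> E" using Z by (simp add: cocycles_def)
  obtain w :: "'a set \<Rightarrow> int" where w: "\<And>A. even (sum w (boundary E A))" "odd (sum w Z)"
    using non_boundary_weight[OF graph con ZE Z(2)] by auto
  define w' where "w' = w \<circ> inv_into E faces"
  have w': "sum w' (faces ` X) = sum w X" if "X \<subseteq> E" for X
  proof -
    have "sum w' (faces ` X) = sum (w' \<circ> faces) X"
      by (rule sum.reindex) (use inj_faces that in \<open>auto intro: inj_on_subset\<close>)
    also have "\<dots> = sum w X" using that inj_faces by (intro sum.cong) (auto simp: w'_def)
    finally show ?thesis .
  qed
  have "\<exists>J. near_matching F dual J \<and> (even (sum w' J) \<longleftrightarrow> even (sum w E))"
  proof (rule near_matching_parity[OF dual_graph dual_connected F_ne dual_cubic dual_bridgeless])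
    show "faces ` Z \<subseteq> dual" using ZE by (auto simp: dual_def)
    show "even (degree (faces ` Z) f)" if "f \<in> F" for f
      using Z(1) degree_dual[OF that ZE] that by (simp add: cocycles_def)
    show "odd (sum w' (faces ` Z))" using w' ZE w(2) by simp
  qed
  then obtain J where J: "near_matching F dual J" "even (sum w' J) \<longleftrightarrow> even (sum w E)" by blast
  define T where "T = {e \<in> E. faces e \<in> J}"
  have TE: "T \<subseteq> E" by (auto simp: T_def)
  have "J = faces ` T" using J(1) by (auto simp: near_matching_def dual_def T_def)
  then have "even (sum w T) \<longleftrightarrow> even (sum w E)" using J(2) w'[OF TE] by simp
  moreover have "sum w E = sum w (E - T) + sum w T" using sum.subset_diff[OF TE finE] .
  ultimately have ev: "even (sum w (E - T))" by auto
  have co: "E - T \<in> cocycles" using near_matching_complement(1)[OF J(1) T_def] .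
  have "E - T \<in> boundary E ` Pow V"
  proof (rule ccontr)
    assume "E - T \<notin> boundary E ` Pow V"
    then have "sym_diff (E - T) Z \<in> boundary E ` Pow V" using sym_diff_boundary[OF co Z(1) _ Z(2)] by blast
    then have "even (sum w (sym_diff (E - T) Z))" using w(1) by auto
    moreover have "finite Z" using ZE finE finite_subset by blast
    ultimately show False using even_sum_sym_diff[of "E - T" Z w] finE ev w(2) by auto
  qed
  then show ?thesis using J(1) T_def by blast
qed

end

theorem theorem1p8:
  fixes V :: "'a set" and E :: "'a set set" and F :: "'f set" and tri :: "'f \<Rightarrow> 'a set"
  assumes "projective_plane_triangulation V E F tri"
  shows "\<exists>H. bipartite_subgraph E H \<and> real (card H) \<ge> 2 / 3 * real (card E) - 1"
proof -
  interpret projective_triangulation V E F tri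
    using assms by unfold_locales (auto simp: projective_plane_triangulation_def)
  obtain J A where J: "near_matching F dual J" and A: "E - {e \<in> E. faces e \<in> J} = boundary E A"
    using ex_near_matching_boundary by blast
  define T where "T = {e \<in> E. faces e \<in> J}"
  have "bipartite_subgraph E (E - T)"
    unfolding bipartite_subgraph_def using A by (auto simp: T_def boundary_def)
  moreover have "card E = card (E - T) + card T"
    using finE by (subst card_Un_disjoint[symmetric]) (auto simp: T_def intro!: arg_cong[of _ _ card])
  then have "real (card (E - T)) \<ge> 2 / 3 * real (card E) - 1"
    using near_matching_complement(2)[OF J T_def] by linarith
  ultimately show ?thesis by blast
qed

end
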